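(* Let $(X_m)_{m\in\mathbb{N}}$ be a homogeneous Markov chain on a finite or denumerable state space $\mathcal{E}$ and let $E^{\rm o}\subset E^{\dag}\subset\mathcal{E}$ satisfy assumptions $(A_1)$ and $(A_2)$ stated in the context. Let $F\subset\mathcal{E}$. The generating function $K_i$, $i\in\mathcal{E}$, satisfies the equation $$K_i(x,y)=K_i(x,0)+K_i(0,y)+\sum_{j\in E^{\rm o}}\Big(H_{ij}^{\rm o\dag}(x)+\frac{x}{y}\,H_{ij}^{\rm o-}(y)\Big)K_j(x,y)-\sum_{j\in E^{\rm o}}H_{ij}^{\rm o\dag}(x)\,K_j(x,0)-\mathbf{1}_F(i)$$ where, for any $i\in\mathcal{E}$, $$K_i(x,0)=G_i(x)-\sum_{j\in E^-}H_{ij}^-(x)\,G_j(x),\qquad K_i(0,y)=G_i(y)-\sum_{j\in E^{\dag}}H_{ij}^{\dag}(y)\,G_j(y),$$ and where the functions $H^-_{ij}$ ($j\in E^-$) and $H^{\dag}_{ij}$ ($j\in E^{\dag}$) are given by the equations $$G_{ij}(x)=\delta_{ij}+\sum_{k\in E^{\dag}}H_{ik}^{\dag}(x)G_{kj}(x)\ \ (i\in\mathcal{E},\,j\in E^{\dag}),\qquad G_{ij}(x)=\delta_{ij}+\sum_{k\in E^-}H_{ik}^-(x)G_{kj}(x)\ \ (i\in\mathcal{E},\,j\in E^-),$$ and the functions $H^{\rm o\dag}_{ij}$ and $H^{\rm o-}_{ij}$ ($j\in E^{\rm o}$) are given by $$H_{ij}^{\rm o\dag}(x)=x\Big(p_{ij}+\sum_{k\in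 E^+}p_{ik}H_{kj}^{\rm o}(x)\Big),\qquad H_{ij}^{\rm o-}(x)=x\sum_{k\in E^-}p_{ik}H_{kj}^{\rm o}(x).$$
   Context: Notation: $\mathbb{N}=\{0,1,2,\dots\}$, $\mathbb{N}^*=\{1,2,\dots\}$, $\min(\varnothing)=+\infty$; $\mathbb{P}_i$, $\mathbb{E}_i$ denote probability and expectation given $X_0=i$; $p_{ij}=\mathbb{P}_i\{X_1=j\}$; $\delta_{ij}$ is the Kronecker symbol; $\mathbf{1}_F$ is the indicator of $F$. Set $E^+=E^{\dag}\setminus E^{\rm o}$, $E^-=\mathcal{E}\setminus E^{\dag}$. For $u\in\{{\rm o},\dag,+,-\}$ let $\tau^u=\min\{m\in\mathbb{N}^*:X_m\in E^u\}$. Assumptions. $(A_1)$: if $X_0\in E^-$, then $\tau^{\rm o}=\tau^{\dag}$ (the chain started outside $E^{\dag}$ enters $E^{\dag}$ necessarily through $E^{\rm o}$). $(A_2)$: if $X_0\in E^+$, then $\tau^{\rm o}\le\tau^--1$ (the chain started in $E^+$ exits $E^{\dag}$ necessarily through $E^{\rm o}$). (These hold almost surely.) Sojourn time: $T_0=0$ and $T_n=\#\{m\in\{1,\dots,n\}:X_m\in E^{\dag}\}$ for $n\ge1$. Generating functions: $G_{ij}(x)=\sum_{m\ge0}\mathbb{P}_i\{X_m=j\}x^m$; $G_i(x)=\sum_{m\ge0}\mathbb{P}_i\{X_m\in F\}x^m=\sum_{j\in F}G_{ij}(x)$; for $u\in\{{\rm o},\dag,+,-\}$, $H^u_{ij}(x)=\mathbb{E}_i\big(x^{\tau^u}\mathbf{1}_{\{\tau^u<\infty,\,X_{\tau^u}=j\}}\big)$;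 for $j\in E^{\rm o}$ and $v\in\{\dag,+,-\}$, $H^{{\rm o}v}_{ij}(x)=\mathbb{E}_i\big(x^{\tau^{\rm o}}\mathbf{1}_{\{X_1\in E^v,\,\tau^{\rm o}<\infty,\,X_{\tau^{\rm o}}=j\}}\big)$; and $$K_i(x,y)=\sum_{m,n\in\mathbb{N}:\,m\le n}\mathbb{P}_i\{T_n=m,\,X_n\in F\}\,x^my^{n-m}$$ (with $0^0=1$, so that $K_i(x,0)=\sum_n\mathbb{P}_i\{T_n=n,X_n\in F\}x^n$ and $K_i(0,y)=\sum_n\mathbb{P}_i\{T_n=0,X_n\in F\}y^n$). Identities are understood for real $x,y$ such that all the series involved converge absolutely (in particular for $|x|<1$, $|y|<1$), with $y\neq0$ where one divides by $y$. *)

theory Defs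
  imports "HOL-Probability.Probability"
begin

text \<open>The state space is the whole type \<open>'s :: countable\<close>, i.e. finite or denumerable;
  \<open>P i\<close> is the law of the chain started at \<open>i\<close>.\<close>

definition trans_prob :: "('s \<Rightarrow> 'w measure) \<Rightarrow> (nat \<Rightarrow> 'w \<Rightarrow> 's) \<Rightarrow> 's \<Rightarrow> 's \<Rightarrow> real" where
  "trans_prob P X i j = \<P>(w in P i. X 1 w = j)"

locale homogeneous_markov_chain =
  fixes P :: "'s::countable \<Rightarrow> 'w measure" and X :: "nat \<Rightarrow> 'w \<Rightarrow> 's"
  assumes prob_space_P: "prob_space (P i)"
    and measurable_X: "X m \<in> measurable (P i) (count_space UNIV)"
    and start: "AE w in P i. X 0 w = i"
    and markov: "\<P>(w in P i. \<forall>m\<le>n. X m w = s m) \<noteq> 0 \<Longrightarrow>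
      \<P>(w in P i. X (Suc n) w = j \<bar> \<forall>m\<le>n. X m w = s m) = trans_prob P X (s n) j"

definition hit :: "(nat \<Rightarrow> 'w \<Rightarrow> 's) \<Rightarrow> 's set \<Rightarrow> 'w \<Rightarrow> enat" where
  "hit X A w = (INF m\<in>{m. 1 \<le> m \<and> X m w \<in> A}. enat m)"

definition assumption_A1 ::
  "('s \<Rightarrow> 'w measure) \<Rightarrow> (nat \<Rightarrow> 'w \<Rightarrow> 's) \<Rightarrow> 's set \<Rightarrow> 's set \<Rightarrow> bool" where
  "assumption_A1 P X Eo Ed \<longleftrightarrow> (\<forall>i\<in>- Ed. AE w in P i. hit X Eo w = hit X Ed w)"

text \<open>Hitting times are at least 1, so the subtraction on \<open>enat\<close> does not truncate;
  moreover \<open>\<infinity> - 1 = \<infinity>\<close>.\<close>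

definition assumption_A2 ::
  "('s \<Rightarrow> 'w measure) \<Rightarrow> (nat \<Rightarrow> 'w \<Rightarrow> 's) \<Rightarrow> 's set \<Rightarrow> 's set \<Rightarrow> bool" where
  "assumption_A2 P X Eo Ed \<longleftrightarrow> (\<forall>i\<in>Ed - Eo. AE w in P i. hit X Eo w \<le> hit X (- Ed) w - 1)"

definition sojourn :: "(nat \<Rightarrow> 'w \<Rightarrow> 's) \<Rightarrow> 's set \<Rightarrow> nat \<Rightarrow> 'w \<Rightarrow> nat" where
  "sojourn X Ed n w = card {m \<in> {1..n}. X m w \<in> Ed}"


subsection \<open>Generating functions\<close>

text \<open>Each generating function comes with a predicate stating that its series converges
  absolutely. For real families, \<open>summable_on\<close> of the absolute values is absolute convergence,
  and Bochner integrability plays this role for the functions given as expectations.\<close>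

definition G :: "('s \<Rightarrow> 'w measure) \<Rightarrow> (nat \<Rightarrow> 'w \<Rightarrow> 's) \<Rightarrow> 's \<Rightarrow> 's \<Rightarrow> real \<Rightarrow> real" where
  "G P X i j x = (\<Sum>\<^sub>\<infinity>m. \<P>(w in P i. X m w = j) * x ^ m)"

definition G_conv :: "('s \<Rightarrow> 'w measure) \<Rightarrow> (nat \<Rightarrow> 'w \<Rightarrow> 's) \<Rightarrow> 's \<Rightarrow> 's \<Rightarrow> real \<Rightarrow> bool" where
  "G_conv P X i j x \<longleftrightarrow> (\<lambda>m. \<bar>\<P>(w in P i. X m w = j) * x ^ m\<bar>) summable_on UNIV"

definition GF :: "('s \<Rightarrow> 'w measure) \<Rightarrow> (nat \<Rightarrow> 'w \<Rightarrow> 's) \<Rightarrow> 's set \<Rightarrow> 's \<Rightarrow> real \<Rightarrow> real" where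
  "GF P X F i x = (\<Sum>\<^sub>\<infinity>m. \<P>(w in P i. X m w \<in> F) * x ^ m)"

definition GF_conv :: "('s \<Rightarrow> 'w measure) \<Rightarrow> (nat \<Rightarrow> 'w \<Rightarrow> 's) \<Rightarrow> 's set \<Rightarrow> 's \<Rightarrow> real \<Rightarrow> bool" where
  "GF_conv P X F i x \<longleftrightarrow> (\<lambda>m. \<bar>\<P>(w in P i. X m w \<in> F) * x ^ m\<bar>) summable_on UNIV"

text \<open>\<open>H P X A i j\<close> is \<open>H\<^sub>i\<^sub>j\<^sup>u\<close> for \<open>A = E\<^sup>u\<close>, and \<open>Ho P X Eo V i j\<close> is \<open>H\<^sub>i\<^sub>j\<^sup>o\<^sup>v\<close> for \<open>V = E\<^sup>v\<close>.\<close>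

definition H_term :: "(nat \<Rightarrow> 'w \<Rightarrow> 's) \<Rightarrow> 's set \<Rightarrow> 's \<Rightarrow> real \<Rightarrow> 'w \<Rightarrow> real" where
  "H_term X A j x w =
    (if hit X A w < \<infinity> \<and> X (the_enat (hit X A w)) w = j then x ^ the_enat (hit X A w) else 0)"

definition H :: "('s \<Rightarrow> 'w measure) \<Rightarrow> (nat \<Rightarrow> 'w \<Rightarrow> 's) \<Rightarrow> 's set \<Rightarrow> 's \<Rightarrow> 's \<Rightarrow> real \<Rightarrow> real" where
  "H P X A i j x = (\<integral>w. H_term X A j x w \<partial>P i)"

definition H_conv ::
  "('s \<Rightarrow> 'w measure) \<Rightarrow> (nat \<Rightarrow> 'w \<Rightarrow> 's) \<Rightarrow> 's set \<Rightarrow> 's \<Rightarrow> 's \<Rightarrow> real \<Rightarrow> bool" where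
  "H_conv P X A i j x \<longleftrightarrow> integrable (P i) (H_term X A j x)"

definition Ho ::
  "('s \<Rightarrow> 'w measure) \<Rightarrow> (nat \<Rightarrow> 'w \<Rightarrow> 's) \<Rightarrow> 's set \<Rightarrow> 's set \<Rightarrow> 's \<Rightarrow> 's \<Rightarrow> real \<Rightarrow> real" where
  "Ho P X Eo V i j x = (\<integral>w. (if X 1 w \<in> V then H_term X Eo j x w else 0) \<partial>P i)"

definition Ho_conv ::
  "('s \<Rightarrow> 'w measure) \<Rightarrow> (nat \<Rightarrow> 'w \<Rightarrow> 's) \<Rightarrow> 's set \<Rightarrow> 's set \<Rightarrow> 's \<Rightarrow> 's \<Rightarrow> real \<Rightarrow> bool" where
  "Ho_conv P X Eo V i j x \<longleftrightarrow>
    integrable (P i) (\<lambda>w. if X 1 w \<in> V then H_term X Eo j x w else 0)"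

definition K ::
  "('s \<Rightarrow> 'w measure) \<Rightarrow> (nat \<Rightarrow> 'w \<Rightarrow> 's) \<Rightarrow> 's set \<Rightarrow> 's set \<Rightarrow> 's \<Rightarrow> real \<Rightarrow> real \<Rightarrow> real" where
  "K P X Ed F i x y = (\<Sum>\<^sub>\<infinity>(m, n)\<in>{(m, n). m \<le> n}.
     \<P>(w in P i. sojourn X Ed n w = m \<and> X n w \<in> F) * x ^ m * y ^ (n - m))"

definition K_conv ::
  "('s \<Rightarrow> 'w measure) \<Rightarrow> (nat \<Rightarrow> 'w \<Rightarrow> 's) \<Rightarrow> 's set \<Rightarrow> 's set \<Rightarrow> 's \<Rightarrow> real \<Rightarrow> real \<Rightarrow> bool" where
  "K_conv P X Ed F i x y \<longleftrightarrow> (\<lambda>(m, n).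
     \<bar>\<P>(w in P i. sojourn X Ed n w = m \<and> X n w \<in> F) * x ^ m * y ^ (n - m)\<bar>)
       summable_on {(m, n). m \<le> n}"


subsection \<open>Domains of validity of the identities\<close>

text \<open>Each predicate says that every series occurring in one identity converges absolutely,
  including the series over states.\<close>

definition main_conv ::
  "('s \<Rightarrow> 'w measure) \<Rightarrow> (nat \<Rightarrow> 'w \<Rightarrow> 's) \<Rightarrow> 's set \<Rightarrow> 's set \<Rightarrow> 's set \<Rightarrow> 's \<Rightarrow> real \<Rightarrow> real \<Rightarrow> bool"
  where
  "main_conv P X Eo Ed F i x y \<longleftrightarrow>
     K_conv P X Ed F i x y \<and> K_conv P X Ed F i x 0 \<and> K_conv P X Ed F i 0 y \<and>
     (\<forall>j\<in>Eo. Ho_conv P X Eo Ed i j x \<and> Ho_conv P X Eo (- Ed) i j y \<and>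
              K_conv P X Ed F j x y \<and> K_conv P X Ed F j x 0) \<and>
     (\<lambda>j. \<bar>(Ho P X Eo Ed i j x + x / y * Ho P X Eo (- Ed) i j y) * K P X Ed F j x y\<bar>)
       summable_on Eo \<and>
     (\<lambda>j. \<bar>Ho P X Eo Ed i j x * K P X Ed F j x 0\<bar>) summable_on Eo"

definition Kx0_conv ::
  "('s \<Rightarrow> 'w measure) \<Rightarrow> (nat \<Rightarrow> 'w \<Rightarrow> 's) \<Rightarrow> 's set \<Rightarrow> 's set \<Rightarrow> 's \<Rightarrow> real \<Rightarrow> bool" where
  "Kx0_conv P X Ed F i x \<longleftrightarrow>
     K_conv P X Ed F i x 0 \<and> GF_conv P X F i x \<and>
     (\<forall>j\<in>- Ed. H_conv P X (- Ed) i j x \<and> GF_conv P X F j x) \<and>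
     (\<lambda>j. \<bar>H P X (- Ed) i j x * GF P X F j x\<bar>) summable_on (- Ed)"

definition K0y_conv ::
  "('s \<Rightarrow> 'w measure) \<Rightarrow> (nat \<Rightarrow> 'w \<Rightarrow> 's) \<Rightarrow> 's set \<Rightarrow> 's set \<Rightarrow> 's \<Rightarrow> real \<Rightarrow> bool" where
  "K0y_conv P X Ed F i y \<longleftrightarrow>
     K_conv P X Ed F i 0 y \<and> GF_conv P X F i y \<and>
     (\<forall>j\<in>Ed. H_conv P X Ed i j y \<and> GF_conv P X F j y) \<and>
     (\<lambda>j. \<bar>H P X Ed i j y * GF P X F j y\<bar>) summable_on Ed"

definition G_eq_conv ::
  "('s \<Rightarrow> 'w measure) \<Rightarrow> (nat \<Rightarrow> 'w \<Rightarrow> 's) \<Rightarrow> 's set \<Rightarrow> 's \<Rightarrow> 's \<Rightarrow> real \<Rightarrow> bool" where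
  "G_eq_conv P X A i j x \<longleftrightarrow>
     G_conv P X i j x \<and> (\<forall>k\<in>A. H_conv P X A i k x \<and> G_conv P X k j x) \<and>
     (\<lambda>k. \<bar>H P X A i k x * G P X k j x\<bar>) summable_on A"

definition Ho_eq_conv ::
  "('s \<Rightarrow> 'w measure) \<Rightarrow> (nat \<Rightarrow> 'w \<Rightarrow> 's) \<Rightarrow> 's set \<Rightarrow> 's set \<Rightarrow> 's set \<Rightarrow> 's \<Rightarrow> 's \<Rightarrow> real \<Rightarrow> bool"
  where
  "Ho_eq_conv P X Eo V B i j x \<longleftrightarrow>
     Ho_conv P X Eo V i j x \<and> (\<forall>k\<in>B. H_conv P X Eo k j x) \<and>
     (\<lambda>k. \<bar>trans_prob P X i k * H P X Eo k j x\<bar>) summable_on B"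

end

theory Submission
  imports Defs
begin

text \<open>
  Every function in the theorem is a sum over finite paths. Write a trajectory
  \<open>X\<^sub>1, \<dots>, X\<^sub>n\<close> of the chain started at \<open>i\<close> as a list and weigh it by the product of a kernel
  along its steps, the transition probability of each step being multiplied by \<open>x\<close> when the step
  lands in \<open>E\<^sup>\<dagger>\<close> and by \<open>y\<close> when it lands outside. The functions \<open>G\<close>, \<open>H\<close>, \<open>H\<^sup>o\<^sup>v\<close> and \<open>K\<close> are then
  the total weights of sets of paths: paths ending at \<open>j\<close> or in \<open>F\<close>, and first-passage paths
  (lemmas \<open>GF_eq\<close>, \<open>K_eq\<close>, \<open>Ho_eq\<close>, \<open>H_eq\<close>). Each of these sums converges absolutely exactly
  when the defining series does, because all probabilities involved are nonnegative.

  Weights are multiplicative under concatenation. Hence, if a set of paths is obtained by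
  concatenating uniquely a first piece and a continuation that depends only on the state reached,
  its total weight is \<open>\<Sum>\<^sub>j\<close> (weight of first pieces ending at \<open>j\<close>) \<open>\<cdot>\<close> (weight of continuations
  from \<open>j\<close>), as soon as the weights of the composite paths are summable (\<open>path_sum_concat\<close>). This
  is the strong Markov property in the only form used here. The identities come from
  different ways of cutting:

  \<^item> cutting at the first visit to a set \<open>A\<close> gives the equations for \<open>G\<close> and, since
    \<open>T\<^sub>n = n\<close> means that \<open>E\<^sup>-\<close> has been avoided and \<open>T\<^sub>n = 0\<close> that \<open>E\<^sup>\<dagger>\<close> has been avoided, the formulas
    for \<open>K(x,0)\<close> and \<open>K(0,y)\<close> (\<open>path_sum_avoiding\<close>);
  \<^item> cutting after the first step gives the formulas for \<open>H\<^sup>o\<^sup>\<dagger>\<close> and \<open>H\<^sup>o\<^sup>-\<close>;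
  \<^item> for the main equation (\<open>path_sum_gateway\<close>), the nonempty paths ending in \<open>F\<close> are of four kinds:
    staying in \<open>E\<^sup>\<dagger>\<close>, avoiding \<open>E\<^sup>\<dagger>\<close>, and visiting both sides with first step inside or outside
    \<open>E\<^sup>\<dagger>\<close>. The empty path belongs to both \<open>K(x,0)\<close> and \<open>K(0,y)\<close>, whence the correction by the
    indicator of \<open>F\<close>. By the two assumptions, a path of positive probability of one of the last
    two kinds must visit \<open>E\<^sup>o\<close>; it is cut at the first such visit. If the first step is inside, the first piece lies entirely in \<open>E\<^sup>\<dagger>\<close>, so
    its weight is \<open>x\<close> to its length, and the continuation is any path that leaves \<open>E\<^sup>\<dagger>\<close>, of total
    weight \<open>K\<^sub>j(x,y) - K\<^sub>j(x,0)\<close>. If the first step is outside, only the last step of the first piece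
    is in \<open>E\<^sup>\<dagger>\<close>, so its weight is \<open>x/y\<close> times \<open>y\<close> to its length, and the continuation is arbitrary.

  For uniqueness, cutting a path at its last but one visit to \<open>A\<close> gives \<open>G = I + G H\<close> on \<open>A\<close>, as
  opposed to \<open>G = I + H G\<close>. If \<open>d\<close> is the difference of two summable solutions, then \<open>d G = 0\<close>, so
  \<open>d = d (G - G H) = d G - (d G) H = 0\<close> (\<open>green_function_injective\<close>).
\<close>

section \<open>Grouping the terms of absolutely convergent families\<close>

lemma summable_on_abs_iff: "(\<lambda>s. \<bar>f s :: real\<bar>) summable_on S \<longleftrightarrow> f summable_on S"
  using summable_on_iff_abs_summable_on_real[of f S] by simp

text \<open>
  Absolute convergence of the whole family gives both the convergence within each class and the
  convergence of the series of class sums.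
\<close>
lemma has_sum_fibers:
  fixes f :: "'a \<Rightarrow> real"
  assumes "f summable_on S" and "k ` S \<subseteq> J"
  shows "((\<lambda>j. \<Sum>\<^sub>\<infinity>s\<in>{s \<in> S. k s = j}. f s) has_sum infsum f S) J"
proof -
  have bij: "bij_betw snd (SIGMA j:J. {s \<in> S. k s = j}) S"
    using assms(2) by (auto simp: bij_betw_def inj_on_def image_iff)
  have "((\<lambda>z. f (snd z)) has_sum infsum f S) (SIGMA j:J. {s \<in> S. k s = j})"
    using has_sum_reindex_bij_betw[OF bij, of f] assms(1) by simp
  then show ?thesis
  proof (rule has_sum_SigmaD)
    fix j assume "j \<in> J"
    have "f summable_on {s \<in> S. k s = j}"
      using assms(1) by (rule summable_on_subset_banach) auto
    then show "((\<lambda>y. f (snd (j, y))) has_sum (\<Sum>\<^sub>\<infinity>s\<in>{s \<in> S. k s = j}. f s)) {s \<in> S. k s = j}"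
      by simp
  qed
qed

text \<open>
  A power series whose coefficients are probabilities, each a sum over a class of paths, is turned
  by this lemma into a sum over single paths. Nonnegativity of \<open>f\<close> rules out cancellation inside a
  class, which makes the two notions of convergence equivalent and not merely comparable. The
  equality of the values is then unconditional, since a divergent \<open>infsum\<close> is \<open>0\<close>.
\<close>
lemma summable_on_fibers_iff:
  fixes f :: "'a \<Rightarrow> real" and c :: "'k \<Rightarrow> real"
  assumes nonneg: "\<And>s. s \<in> S \<Longrightarrow> 0 \<le> f s"
    and fiber: "\<And>j. j \<in> J \<Longrightarrow> f summable_on {s \<in> S. k s = j}" and "k ` S \<subseteq> J"
  shows "(\<lambda>j. (\<Sum>\<^sub>\<infinity>s\<in>{s \<in> S. k s = j}. f s) * c j) summable_on J \<longleftrightarrow>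
         (\<lambda>s. f s * c (k s)) summable_on S" (is ?A)
    and "(\<Sum>\<^sub>\<infinity>j\<in>J. (\<Sum>\<^sub>\<infinity>s\<in>{s \<in> S. k s = j}. f s) * c j) = (\<Sum>\<^sub>\<infinity>s\<in>S. f s * c (k s))" (is ?B)
proof -
  have inner: "(\<Sum>\<^sub>\<infinity>s\<in>{s \<in> S. k s = j}. f s * c (k s)) = (\<Sum>\<^sub>\<infinity>s\<in>{s \<in> S. k s = j}. f s) * c j" for j
  proof -
    have "(\<Sum>\<^sub>\<infinity>s\<in>{s \<in> S. k s = j}. f s * c (k s)) = (\<Sum>\<^sub>\<infinity>s\<in>{s \<in> S. k s = j}. f s * c j)"
      by (rule infsum_cong) auto
    then show ?thesis by (simp add: infsum_cmult_left')
  qed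
  have bij: "bij_betw snd (SIGMA j:J. {s \<in> S. k s = j}) S"
    using assms(3) by (auto simp: bij_betw_def inj_on_def image_iff)
  have "(\<lambda>s. f s * c (k s)) summable_on S"
    if sm: "(\<lambda>j. (\<Sum>\<^sub>\<infinity>s\<in>{s \<in> S. k s = j}. f s) * c j) summable_on J"
  proof -
    have "(\<lambda>z. \<bar>f (snd z) * c (k (snd z))\<bar>) summable_on (SIGMA j:J. {s \<in> S. k s = j})"
    proof (rule summable_on_SigmaI)
      fix j assume j: "j \<in> J"
      have "((\<lambda>s. f s * \<bar>c j\<bar>) has_sum ((\<Sum>\<^sub>\<infinity>s\<in>{s \<in> S. k s = j}. f s) * \<bar>c j\<bar>)) {s \<in> S. k s = j}"
        by (intro has_sum_cmult_left has_sum_infsum fiber j)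
      then show "((\<lambda>s. \<bar>f (snd (j, s)) * c (k (snd (j, s)))\<bar>) has_sum
          ((\<Sum>\<^sub>\<infinity>s\<in>{s \<in> S. k s = j}. f s) * \<bar>c j\<bar>)) {s \<in> S. k s = j}"
        by (rule has_sum_cong[THEN iffD1, rotated]) (auto simp: abs_mult nonneg)
    next
      have "0 \<le> (\<Sum>\<^sub>\<infinity>s\<in>{s \<in> S. k s = j}. f s)" for j
        using nonneg by (auto intro: infsum_nonneg)
      then have "\<bar>(\<Sum>\<^sub>\<infinity>s\<in>{s \<in> S. k s = j}. f s) * c j\<bar> = (\<Sum>\<^sub>\<infinity>s\<in>{s \<in> S. k s = j}. f s) * \<bar>c j\<bar>" for j
        by (simp add: abs_mult)
      then show "(\<lambda>j. (\<Sum>\<^sub>\<infinity>s\<in>{s \<in> S. k s = j}. f s) * \<bar>c j\<bar>) summable_on J"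
        using sm by (subst (asm) summable_on_iff_abs_summable_on_real) simp
    qed auto
    then have "(\<lambda>s. \<bar>f s * c (k s)\<bar>) summable_on S"
      using summable_on_reindex_bij_betw[OF bij, of "\<lambda>s. \<bar>f s * c (k s)\<bar>"] by simp
    then show ?thesis
      by (subst summable_on_iff_abs_summable_on_real) simp
  qed
  moreover have *: "((\<lambda>j. (\<Sum>\<^sub>\<infinity>s\<in>{s \<in> S. k s = j}. f s) * c j) has_sum (\<Sum>\<^sub>\<infinity>s\<in>S. f s * c (k s))) J"
    if "(\<lambda>s. f s * c (k s)) summable_on S"
    using has_sum_fibers[OF that assms(3)] by (simp only: inner)
  ultimately have iff: "(\<lambda>j. (\<Sum>\<^sub>\<infinity>s\<in>{s \<in> S. k s = j}. f s) * c j) summable_on J \<longleftrightarrow>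
      (\<lambda>s. f s * c (k s)) summable_on S"
    using has_sum_imp_summable by blast
  then show ?A .
  show ?B
  proof (cases "(\<lambda>s. f s * c (k s)) summable_on S")
    case True
    then show ?thesis by (rule infsumI[OF *])
  next
    case False
    with iff show ?thesis by (simp add: infsum_not_exists)
  qed
qed

lemma summable_on_mult_bounded:
  fixes f g :: "'a \<Rightarrow> real"
  assumes "(\<lambda>j. \<bar>f j\<bar>) summable_on J" and "\<And>j. j \<in> J \<Longrightarrow> \<bar>g j\<bar> \<le> B"
  shows "(\<lambda>j. \<bar>f j * g j\<bar>) summable_on J"
proof (rule summable_on_comparison_test)
  show "(\<lambda>j. \<bar>f j\<bar> * B) summable_on J" by (intro summable_on_cmult_left assms)
  show "\<bar>f j * g j\<bar> \<le> \<bar>f j\<bar> * B" if "j \<in> J" for j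
    unfolding abs_mult by (intro mult_left_mono assms that) auto
qed auto

section \<open>Weighted sums over paths\<close>

primrec path_weight :: "('s \<Rightarrow> 's \<Rightarrow> real) \<Rightarrow> 's \<Rightarrow> 's list \<Rightarrow> real" where
  "path_weight q i [] = 1"
| "path_weight q i (a # s) = q i a * path_weight q a s"

text \<open>
  A path from \<open>i\<close> is the list of the states after \<open>i\<close>; the state it has reached is therefore
  \<open>last (i # s)\<close>, which is \<open>i\<close> itself for the empty path.
\<close>
definition path_sum :: "('s \<Rightarrow> 's \<Rightarrow> real) \<Rightarrow> 's \<Rightarrow> 's list set \<Rightarrow> real" where
  "path_sum q i S = (\<Sum>\<^sub>\<infinity>s\<in>S. path_weight q i s)"

lemma path_weight_append:
  "path_weight q i (u @ t) = path_weight q i u * path_weight q (last (i # u)) t"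
  by (induction u arbitrary: i) auto

lemma path_sum_empty [simp]: "path_sum q i {} = 0"
  and path_sum_single [simp]: "path_sum q i {s} = path_weight q i s"
  by (simp_all add: path_sum_def)

lemma path_sum_Un_disjoint:
  assumes "path_weight q i summable_on S" "path_weight q i summable_on T" "S \<inter> T = {}"
  shows "path_sum q i (S \<union> T) = path_sum q i S + path_sum q i T"
  using assms unfolding path_sum_def by (rule infsum_Un_disjoint)

text \<open>
  The decomposition principle behind all identities: the continuation \<open>t\<close> of a first piece \<open>u\<close> is
  weighted only through the state that \<open>u\<close> has reached, so the sum over \<open>u @ t\<close> factorises once
  first pieces are grouped by that state.
\<close>
lemma path_sum_concat:
  assumes bij: "bij_betw (\<lambda>(u, t). u @ t) (SIGMA u:U. T (last (i # u))) C"
    and summ: "path_weight q i summable_on C"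
    and ends: "\<And>u. u \<in> U \<Longrightarrow> last (i # u) \<in> J"
  shows "((\<lambda>j. path_sum q i {u \<in> U. last (i # u) = j} * path_sum q j (T j))
            has_sum path_sum q i C) J"
proof -
  let ?e = "\<lambda>u. last (i # u)"
  have hs: "((\<lambda>(u, t). path_weight q i (u @ t)) has_sum path_sum q i C) (SIGMA u:U. T (?e u))"
    using has_sum_reindex_bij_betw[OF bij, of "path_weight q i"] summ
    by (simp add: path_sum_def case_prod_unfold)
  have "((\<lambda>u. path_weight q i u * path_sum q (?e u) (T (?e u))) has_sum path_sum q i C) U"
    using hs
  proof (rule has_sum_SigmaD)
    fix u assume u: "u \<in> U"
    have "(\<lambda>t. path_weight q i (u @ t)) summable_on T (?e u)"
      using summable_on_SigmaD1[OF has_sum_imp_summable[OF hs] u] .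
    then show "((\<lambda>t. case (u, t) of (u, t) \<Rightarrow> path_weight q i (u @ t)) has_sum
        (path_weight q i u * path_sum q (?e u) (T (?e u)))) (T (?e u))"
      by (simp add: has_sum_iff path_sum_def path_weight_append infsum_cmult_right')
  qed
  then have summU: "(\<lambda>u. path_weight q i u * path_sum q (?e u) (T (?e u))) summable_on U"
    and eqU: "(\<Sum>\<^sub>\<infinity>u\<in>U. path_weight q i u * path_sum q (?e u) (T (?e u))) = path_sum q i C"
    by (simp_all add: has_sum_iff)
  have inner: "(\<Sum>\<^sub>\<infinity>u\<in>{u \<in> U. ?e u = j}. path_weight q i u * path_sum q (?e u) (T (?e u))) =
      path_sum q i {u \<in> U. ?e u = j} * path_sum q j (T j)" for j
  proof -
    have "(\<Sum>\<^sub>\<infinity>u\<in>{u \<in> U. ?e u = j}. path_weight q i u * path_sum q (?e u) (T (?e u))) =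
        (\<Sum>\<^sub>\<infinity>u\<in>{u \<in> U. ?e u = j}. path_weight q i u * path_sum q j (T j))"
      by (rule infsum_cong) auto
    then show ?thesis by (simp add: infsum_cmult_left' path_sum_def)
  qed
  show ?thesis
    using has_sum_fibers[OF summU, of ?e J] ends by (simp only: inner eqU image_subset_iff) blast
qed

text \<open>
  Putting the variables of a generating function into the kernel makes the monomial
  \<open>x ^ m * y ^ (n - m)\<close> multiplicative along paths together with the probability.
\<close>
definition step_weight :: "('s \<Rightarrow> 's \<Rightarrow> real) \<Rightarrow> 's set \<Rightarrow> real \<Rightarrow> real \<Rightarrow> 's \<Rightarrow> 's \<Rightarrow> real" where
  "step_weight p A x y a b = p a b * (if b \<in> A then x else y)"

lemma path_weight_step_weight:
  "path_weight (step_weight p A x y) i s = path_weight p i s *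
     (x ^ length (filter (\<lambda>a. a \<in> A) s) * y ^ length (filter (\<lambda>a. a \<notin> A) s))"
  by (induction s arbitrary: i) (auto simp: step_weight_def algebra_simps)

lemma path_weight_step_weight_same:
  "path_weight (step_weight p A x x) i s = path_weight p i s * x ^ length s"
  by (induction s arbitrary: i) (auto simp: step_weight_def algebra_simps)

lemma path_weight_nonneg: "(\<And>a b. 0 \<le> q a b) \<Longrightarrow> 0 \<le> path_weight q i s"
  by (induction s arbitrary: i) auto

lemma path_weight_abs: "path_weight (\<lambda>a b. \<bar>q a b\<bar>) i s = \<bar>path_weight q i s\<bar>"
  by (induction s arbitrary: i) (auto simp: abs_mult)

text \<open>
  Setting a variable to zero kills exactly the paths that visit the corresponding side, so it acts
  as a restriction on the set of paths; the other value of the variable is then immaterial. The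
  empty path survives because \<open>0 ^ 0 = 1\<close>.
\<close>
lemma path_sum_step_weight_inside:
  "path_sum (step_weight p A x 0) i S = path_sum (step_weight p A x y) i {s \<in> S. set s \<inter> - A = {}}"
  unfolding path_sum_def
proof (rule infsum_cong_neutral)
  fix s assume "s \<in> S - {s \<in> S. set s \<inter> - A = {}}"
  then have "filter (\<lambda>a. a \<notin> A) s \<noteq> []" by (auto simp: filter_empty_conv)
  then show "path_weight (step_weight p A x 0) i s = 0" by (simp add: path_weight_step_weight)
next
  fix s assume "s \<in> S \<inter> {s \<in> S. set s \<inter> - A = {}}"
  then have "filter (\<lambda>a. a \<notin> A) s = []" by (auto simp: filter_empty_conv)
  then show "path_weight (step_weight p A x 0) i s = path_weight (step_weight p A x y) i s"
    by (simp add: path_weight_step_weight)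
qed auto

lemma path_sum_step_weight_outside:
  "path_sum (step_weight p A 0 y) i S = path_sum (step_weight p A x y) i {s \<in> S. set s \<inter> A = {}}"
  unfolding path_sum_def
proof (rule infsum_cong_neutral)
  fix s assume "s \<in> S - {s \<in> S. set s \<inter> A = {}}"
  then have "filter (\<lambda>a. a \<in> A) s \<noteq> []" by (auto simp: filter_empty_conv)
  then show "path_weight (step_weight p A 0 y) i s = 0" by (simp add: path_weight_step_weight)
next
  fix s assume "s \<in> S \<inter> {s \<in> S. set s \<inter> A = {}}"
  then have "filter (\<lambda>a. a \<in> A) s = []" by (auto simp: filter_empty_conv)
  then show "path_weight (step_weight p A 0 y) i s = path_weight (step_weight p A x y) i s"
    by (simp add: path_weight_step_weight)
qed auto

section \<open>First passages\<close>

definition first_passages :: "'s set \<Rightarrow> 's list set" where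
  "first_passages A = {u. u \<noteq> [] \<and> last u \<in> A \<and> set (butlast u) \<inter> A = {}}"

text \<open>First-passage paths form a prefix code, so a path is cut at a first passage in one way only.\<close>
lemma first_passages_prefix:
  assumes "u @ v \<in> first_passages A" and "u \<in> first_passages A"
  shows "v = []"
proof (rule ccontr)
  assume "v \<noteq> []"
  then have "last u \<in> set (butlast (u @ v))"
    using assms(2) by (auto simp: first_passages_def butlast_append)
  then show False using assms by (auto simp: first_passages_def)
qed

lemma first_passages_append_inj:
  assumes "u @ t = u' @ t'" and "u \<in> first_passages A" "u' \<in> first_passages A"
  shows "u = u' \<and> t = t'"
proof -
  obtain v where "(u = u' @ v \<and> v @ t = t') \<or> (u @ v = u' \<and> t = v @ t')"
    using append_eq_append_conv2[THEN iffD1, OF assms(1)] by blast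
  then show ?thesis
    using first_passages_prefix[of u' v A] first_passages_prefix[of u v A] assms(2,3) by force
qed

lemma first_passages_split:
  assumes "set s \<inter> A \<noteq> {}"
  obtains u t where "s = u @ t" "u \<in> first_passages A"
proof -
  from assms have "\<exists>a\<in>set s. a \<in> A" by blast
  then obtain ys a zs where "s = ys @ a # zs" "a \<in> A" "\<forall>b\<in>set ys. b \<notin> A"
    using split_list_first_prop[of s "\<lambda>a. a \<in> A"] by blast
  then show thesis
    by (intro that[of "ys @ [a]" zs]) (auto simp: first_passages_def)
qed

lemma path_sum_first_passage:
  assumes "U \<subseteq> first_passages A" and "C = {u @ t | u t. u \<in> U \<and> t \<in> T (last u)}"
    and "path_weight q i summable_on C"
  shows "((\<lambda>j. path_sum q i {u \<in> U. last u = j} * path_sum q j (T j)) has_sum path_sum q i C) A"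
proof -
  have ne: "last (i # u) = last u" "last u \<in> A" if "u \<in> U" for u
    using that assms(1) by (auto simp: first_passages_def)
  have "bij_betw (\<lambda>(u, t). u @ t) (SIGMA u:U. T (last (i # u))) C"
    unfolding bij_betw_def
  proof
    show "inj_on (\<lambda>(u, t). u @ t) (SIGMA u:U. T (last (i # u)))"
    proof (rule inj_onI, clarify)
      fix u t u' t' assume "u @ t = u' @ t'" "u \<in> U" "u' \<in> U"
      then show "u = u' \<and> t = t'"
        using first_passages_append_inj assms(1) by blast
    qed
    show "(\<lambda>(u, t). u @ t) ` (SIGMA u:U. T (last (i # u))) = C"
      using ne(1) by (force simp: assms(2) image_iff)
  qed
  from path_sum_concat[OF this assms(3), of A] ne
  have "((\<lambda>j. path_sum q i {u \<in> U. last (i # u) = j} * path_sum q j (T j)) has_sum path_sum q i C) A"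
    by auto
  moreover have "{u \<in> U. last (i # u) = j} = {u \<in> U. last u = j}" for j
    using ne(1) by (intro Collect_cong) (metis (no_types))
  ultimately show ?thesis by simp
qed

definition paths_into :: "'s \<Rightarrow> 's set \<Rightarrow> 's list set" where
  "paths_into i F = {s. last (i # s) \<in> F}"

lemma paths_into_append [simp]: "u @ t \<in> paths_into i F \<longleftrightarrow> t \<in> paths_into (last (i # u)) F"
  by (auto simp: paths_into_def)

text \<open>Paths that meet \<open>A\<close> are cut at their first visit to \<open>A\<close>.\<close>
lemma path_sum_meeting:
  assumes "path_weight q i summable_on paths_into i F"
  shows "((\<lambda>j. path_sum q i {u \<in> first_passages A. last u = j} * path_sum q j (paths_into j F))
    has_sum path_sum q i {s \<in> paths_into i F. set s \<inter> A \<noteq> {}}) A"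
proof (rule path_sum_first_passage[OF order_refl])
  show "{s \<in> paths_into i F. set s \<inter> A \<noteq> {}} =
      {u @ t |u t. u \<in> first_passages A \<and> t \<in> paths_into (last u) F}"
  proof (intro equalityI subsetI)
    fix s assume "s \<in> {s \<in> paths_into i F. set s \<inter> A \<noteq> {}}"
    then have s: "s \<in> paths_into i F" "set s \<inter> A \<noteq> {}" by auto
    obtain u t where ut: "s = u @ t" "u \<in> first_passages A"
      using first_passages_split[OF s(2)] .
    then have "last (i # u) = last u" by (auto simp: first_passages_def)
    then show "s \<in> {u @ t |u t. u \<in> first_passages A \<and> t \<in> paths_into (last u) F}"
      using s(1) ut by auto
  next
    fix s assume "s \<in> {u @ t |u t. u \<in> first_passages A \<and> t \<in> paths_into (last u) F}"
    then obtain u t where ut: "s = u @ t" "u \<in> first_passages A" "t \<in> paths_into (last u) F"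
      by blast
    then have "u \<noteq> []" "last u \<in> A" by (auto simp: first_passages_def)
    then show "s \<in> {s \<in> paths_into i F. set s \<inter> A \<noteq> {}}"
      using ut by (auto dest: last_in_set)
  qed
  show "path_weight q i summable_on {s \<in> paths_into i F. set s \<inter> A \<noteq> {}}"
    using assms by (rule summable_on_subset_banach) auto
qed

lemma path_sum_avoiding:
  assumes "path_weight q i summable_on paths_into i F"
  shows "path_sum q i (paths_into i F) = path_sum q i {s \<in> paths_into i F. set s \<inter> A = {}} +
    (\<Sum>\<^sub>\<infinity>j\<in>A. path_sum q i {u \<in> first_passages A. last u = j} * path_sum q j (paths_into j F))"
proof -
  have "path_sum q i (paths_into i F) = path_sum q i
      ({s \<in> paths_into i F. set s \<inter> A = {}} \<union> {s \<in> paths_into i F. set s \<inter> A \<noteq> {}})"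
    by (rule arg_cong[where f = "path_sum q i"]) blast
  also have "\<dots> = path_sum q i {s \<in> paths_into i F. set s \<inter> A = {}} +
      path_sum q i {s \<in> paths_into i F. set s \<inter> A \<noteq> {}}"
    by (intro path_sum_Un_disjoint summable_on_subset_banach[OF assms]) auto
  finally show ?thesis
    using infsumI[OF path_sum_meeting[OF assms]] by simp
qed

text \<open>
  Here a nonempty path that ends in \<open>A\<close> is cut at its last visit to \<open>A\<close> strictly before the end,
  where the start \<open>k \<in> A\<close> counts as a visit; what follows that visit is a first-passage path. In
  matrix notation on \<open>A\<close> this is \<open>G = I + G H\<close>, whereas cutting at the first visit gives
  \<open>G = I + H G\<close>.
\<close>
lemma path_sum_last_passage:
  assumes "k \<in> A" "j \<in> A" and "path_weight q k summable_on paths_into k {j}"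
  shows "((\<lambda>l. path_sum q k (paths_into k {l}) * path_sum q l {u \<in> first_passages A. last u = j})
    has_sum path_sum q k (paths_into k {j}) - (if k = j then 1 else 0)) A"
proof -
  let ?C = "paths_into k {j} - {[]}"
  have bij: "bij_betw (\<lambda>(u, t). u @ t)
      (SIGMA u:paths_into k A. {v \<in> first_passages A. last v = j}) ?C"
    unfolding bij_betw_def
  proof
    \<comment> \<open>A longer last excursion would pass through the point of \<open>A\<close> at which the shorter one starts.\<close>
    have suffix: "z = []" if "t' = z @ t" "u = u' @ z" "last (k # u) \<in> A"
        "t \<in> first_passages A" "t' \<in> first_passages A" for u t u' t' z
    proof (rule ccontr)
      assume "z \<noteq> []"
      then have "last z \<in> A" "last z \<in> set (butlast t')"
        using that by (auto simp: first_passages_def butlast_append)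
      then show False using that(5) by (auto simp: first_passages_def)
    qed
    show "inj_on (\<lambda>(u, t). u @ t) (SIGMA u:paths_into k A. {v \<in> first_passages A. last v = j})"
    proof (rule inj_onI, clarify)
      fix u t u' t' assume eq: "u @ t = u' @ t'" and u: "u \<in> paths_into k A" "u' \<in> paths_into k A"
        and t: "t \<in> first_passages A" "t' \<in> first_passages A"
      from eq obtain z where "(u = u' @ z \<and> z @ t = t') \<or> (u @ z = u' \<and> t = z @ t')"
        using append_eq_append_conv2[THEN iffD1, OF eq] by blast
      then show "u = u' \<and> t = t'"
      proof
        assume z: "u = u' @ z \<and> z @ t = t'"
        have "z = []"
          by (rule suffix[of t' z t u u']) (use z u(1) t in \<open>auto simp: paths_into_def\<close>)
        with z show ?thesis by simp
      next
        assume z: "u @ z = u' \<and> t = z @ t'"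
        have "z = []"
          by (rule suffix[of t z t' u' u]) (use z u(2) t in \<open>auto simp: paths_into_def\<close>)
        with z show ?thesis by simp
      qed
    qed
    show "(\<lambda>(u, t). u @ t) ` (SIGMA u:paths_into k A. {v \<in> first_passages A. last v = j}) = ?C"
    proof (intro equalityI subsetI)
      fix s assume s: "s \<in> ?C"
      then have ne: "s \<noteq> []" "last s = j" by (auto simp: paths_into_def)
      have "\<exists>a\<in>set (k # butlast s). a \<in> A" using assms(1) by simp
      then obtain ys a zs where dec: "k # butlast s = ys @ a # zs" "a \<in> A" "\<forall>b\<in>set zs. b \<notin> A"
        using split_list_last_prop[of "k # butlast s" "\<lambda>a. a \<in> A"] by blast
      define u where "u = tl (ys @ [a])"
      have u: "k # u = ys @ [a]" using dec(1) unfolding u_def by (cases ys) auto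
      have "k # butlast s = k # u @ zs" using dec(1) u by simp
      then have "s = u @ zs @ [j]" using ne append_butlast_last_id[OF ne(1)] by simp
      moreover have "u \<in> paths_into k A"
        unfolding paths_into_def mem_Collect_eq u using dec(2) by simp
      moreover have "zs @ [j] \<in> first_passages A"
        using dec(3) assms(2) by (auto simp: first_passages_def)
      ultimately show "s \<in> (\<lambda>(u, t). u @ t) `
          (SIGMA u:paths_into k A. {v \<in> first_passages A. last v = j})"
        by (auto intro!: image_eqI[of _ _ "(u, zs @ [j])"])
    qed (auto simp: paths_into_def first_passages_def)
  qed
  have summ: "path_weight q k summable_on ?C"
    using assms(3) by (rule summable_on_subset_banach) auto
  have "((\<lambda>l. path_sum q k {u \<in> paths_into k A. last (k # u) = l} *
      path_sum q l {u \<in> first_passages A. last u = j}) has_sum path_sum q k ?C) A"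
    by (rule path_sum_concat[OF _ summ, where T = "\<lambda>_. {v \<in> first_passages A. last v = j}"])
       (use bij in \<open>auto simp: paths_into_def\<close>)
  moreover have "{u \<in> paths_into k A. last (k # u) = l} = paths_into k {l}" if "l \<in> A" for l
    using that by (auto simp: paths_into_def)
  then have "path_sum q k {u \<in> paths_into k A. last (k # u) = l} *
        path_sum q l {u \<in> first_passages A. last u = j} =
      path_sum q k (paths_into k {l}) * path_sum q l {u \<in> first_passages A. last u = j}"
    if "l \<in> A" for l
    using that by simp
  ultimately have *: "((\<lambda>l. path_sum q k (paths_into k {l}) *
      path_sum q l {u \<in> first_passages A. last u = j}) has_sum path_sum q k ?C) A"
    using has_sum_cong by (metis (no_types, lifting))
  have "path_sum q k (paths_into k {j}) = path_sum q k (?C \<union> (paths_into k {j} \<inter> {[]}))"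
    by (rule arg_cong[where f = "path_sum q k"]) blast
  also have "\<dots> = path_sum q k ?C + path_sum q k (paths_into k {j} \<inter> {[]})"
    by (intro path_sum_Un_disjoint summ) auto
  also have "paths_into k {j} \<inter> {[]} = (if k = j then {[]} else {})"
    by (auto simp: paths_into_def)
  finally have "path_sum q k ?C = path_sum q k (paths_into k {j}) - (if k = j then 1 else 0)"
    by auto
  with * show ?thesis by simp
qed

lemma first_passages_Cons: "h # v \<in> first_passages A \<longleftrightarrow> (if h \<in> A then v = [] else v \<in> first_passages A)"
  by (auto simp: first_passages_def)

lemma path_sum_first_step:
  assumes "path_weight q i summable_on {k # v | k v. k \<in> B \<and> v \<in> T k}"
  shows "((\<lambda>k. q i k * path_sum q k (T k)) has_sum path_sum q i {k # v | k v. k \<in> B \<and> v \<in> T k}) B"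
proof -
  let ?U = "(\<lambda>k. [k]) ` B"
  have bij: "bij_betw (\<lambda>(u, t). u @ t) (SIGMA u:?U. T (last (i # u))) {k # v | k v. k \<in> B \<and> v \<in> T k}"
    unfolding bij_betw_def
  proof
    show "(\<lambda>(u, t). u @ t) ` (SIGMA u:?U. T (last (i # u))) = {k # v | k v. k \<in> B \<and> v \<in> T k}"
    proof (intro equalityI subsetI)
      fix s assume "s \<in> {k # v | k v. k \<in> B \<and> v \<in> T k}"
      then obtain k v where "s = k # v" "k \<in> B" "v \<in> T k" by blast
      then show "s \<in> (\<lambda>(u, t). u @ t) ` (SIGMA u:?U. T (last (i # u)))"
        by (intro image_eqI[of _ _ "([k], v)"]) auto
    qed auto
  qed (auto simp: inj_on_def)
  have "((\<lambda>k. path_sum q i {u \<in> ?U. last (i # u) = k} * path_sum q k (T k)) has_sum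
      path_sum q i {k # v | k v. k \<in> B \<and> v \<in> T k}) B"
    by (rule path_sum_concat[OF bij assms]) auto
  moreover have "path_sum q i {u \<in> ?U. last (i # u) = k} = q i k" if "k \<in> B" for k
  proof -
    have "{u \<in> ?U. last (i # u) = k} = {[k]}" using that by auto
    then show ?thesis by simp
  qed
  ultimately show ?thesis
    by (simp cong: has_sum_cong)
qed

lemma path_sum_first_passage_avoiding:
  fixes q :: "'s \<Rightarrow> 's \<Rightarrow> real"
  assumes "V \<inter> A = {}"
    and "path_weight q i summable_on {u \<in> first_passages A. hd u \<in> V \<and> last u = j}"
  shows "path_sum q i {u \<in> first_passages A. hd u \<in> V \<and> last u = j} =
    (\<Sum>\<^sub>\<infinity>k\<in>V. q i k * path_sum q k {v \<in> first_passages A. last v = j})"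
proof -
  let ?T = "\<lambda>k. {v \<in> first_passages A. last v = j}"
  have eq: "{u \<in> first_passages A. hd u \<in> V \<and> last u = j} = {k # v | k v. k \<in> V \<and> v \<in> ?T k}"
  proof (intro equalityI subsetI)
    fix u assume u: "u \<in> {u \<in> first_passages A. hd u \<in> V \<and> last u = j}"
    then obtain h v where hv: "u = h # v" by (cases u) (auto simp: first_passages_def)
    with u assms(1) have "h \<notin> A" "h \<in> V" by auto
    with u hv have v: "v \<in> first_passages A" by (simp add: first_passages_Cons)
    then have "v \<noteq> []" by (auto simp: first_passages_def)
    with u hv v \<open>h \<in> V\<close> show "u \<in> {k # v | k v. k \<in> V \<and> v \<in> ?T k}" by auto
  next
    fix u assume "u \<in> {k # v | k v. k \<in> V \<and> v \<in> ?T k}"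
    then obtain k v where u: "u = k # v" "k \<in> V" "v \<in> first_passages A" "last v = j" by blast
    then have "v \<noteq> []" "k \<notin> A" using assms(1) by (auto simp: first_passages_def)
    with u show "u \<in> {u \<in> first_passages A. hd u \<in> V \<and> last u = j}"
      by (simp add: first_passages_Cons)
  qed
  show ?thesis
    unfolding eq by (rule infsumI[symmetric], rule path_sum_first_step) (use assms(2) eq in simp)
qed

text \<open>A first-passage path whose first step is already in \<open>A\<close> is that single step.\<close>
lemma path_sum_first_passage_starting_in:
  fixes q :: "'s \<Rightarrow> 's \<Rightarrow> real"
  assumes "j \<in> A" and "A \<subseteq> V"
    and summ: "path_weight q i summable_on {u \<in> first_passages A. hd u \<in> V \<and> last u = j}"
  shows "path_sum q i {u \<in> first_passages A. hd u \<in> V \<and> last u = j} =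
    q i j + (\<Sum>\<^sub>\<infinity>k\<in>V - A. q i k * path_sum q k {v \<in> first_passages A. last v = j})"
proof -
  let ?R = "{u \<in> first_passages A. hd u \<in> V - A \<and> last u = j}"
  have eq: "{u \<in> first_passages A. hd u \<in> V \<and> last u = j} = {[j]} \<union> ?R"
  proof (intro equalityI subsetI)
    fix u assume u: "u \<in> {u \<in> first_passages A. hd u \<in> V \<and> last u = j}"
    then obtain h v where hv: "u = h # v" by (cases u) (auto simp: first_passages_def)
    with u show "u \<in> {[j]} \<union> ?R" by (cases "h \<in> A") (auto simp: first_passages_Cons)
  qed (use assms(1,2) in \<open>auto simp: first_passages_Cons\<close>)
  have sR: "path_weight q i summable_on ?R"
    using summ by (rule summable_on_subset_banach) auto
  have "path_sum q i ({[j]} \<union> ?R) = path_sum q i {[j]} + path_sum q i ?R"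
    by (rule path_sum_Un_disjoint) (use sR assms(1) in auto)
  also have "path_sum q i ?R = (\<Sum>\<^sub>\<infinity>k\<in>V - A. q i k * path_sum q k {v \<in> first_passages A. last v = j})"
    by (rule path_sum_first_passage_avoiding[OF _ sR]) auto
  finally show ?thesis unfolding eq by simp
qed

section \<open>Sets that can be entered and left only through a gateway\<close>

text \<open>
  The almost sure assumptions on hitting times, expressed through paths of positive probability:
  from outside \<open>Ed\<close>, the first state visited in \<open>Ed\<close> belongs to \<open>Eo\<close>; from \<open>Ed - Eo\<close>, the set \<open>Eo\<close>
  is visited before \<open>Ed\<close> is left. In the second condition a visit anywhere on \<open>u\<close> is
  a visit before the exit, since the last state of \<open>u\<close> lies outside \<open>Ed\<close>.
\<close>
locale gateway =
  fixes p :: "'s \<Rightarrow> 's \<Rightarrow> real" and Eo Ed :: "'s set"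
  assumes Eo_subset: "Eo \<subseteq> Ed"
    and enter_through_Eo: "i \<notin> Ed \<Longrightarrow> u \<in> first_passages Ed \<Longrightarrow> path_weight p i u \<noteq> 0 \<Longrightarrow> last u \<in> Eo"
    and exit_through_Eo:
      "i \<in> Ed - Eo \<Longrightarrow> u \<in> first_passages (- Ed) \<Longrightarrow> path_weight p i u \<noteq> 0 \<Longrightarrow> set u \<inter> Eo \<noteq> {}"
begin

text \<open>
  Leaving \<open>Ed\<close> requires an earlier visit to \<open>Eo\<close>, which would end the first passage before the exit.
\<close>
lemma first_passage_stays_inside:
  assumes u: "u \<in> first_passages Eo" and w: "path_weight p i u \<noteq> 0" and hd: "hd u \<in> Ed"
  shows "set u \<subseteq> Ed"
proof (rule ccontr)
  assume nsub: "\<not> set u \<subseteq> Ed"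
  from u obtain h v where hv: "u = h # v" by (cases u) (auto simp: first_passages_def)
  have "h \<notin> Eo"
  proof
    assume "h \<in> Eo"
    then have "[h] \<in> first_passages Eo" by (auto simp: first_passages_def)
    with u hv have "v = []" using first_passages_prefix[of "[h]" v Eo] by auto
    with nsub hv hd show False by simp
  qed
  with hd hv have h: "h \<in> Ed - Eo" by simp
  have "set v \<inter> - Ed \<noteq> {}" using nsub hv hd by auto
  then obtain v1 v2 where v: "v = v1 @ v2" and v1: "v1 \<in> first_passages (- Ed)"
    using first_passages_split by metis
  have "path_weight p h v1 \<noteq> 0" using w hv v by (auto simp: path_weight_append)
  then have "set (h # v1) \<inter> Eo \<noteq> {}" using exit_through_Eo[OF h v1] by auto
  then obtain u' t' where u': "h # v1 = u' @ t'" "u' \<in> first_passages Eo"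
    using first_passages_split by metis
  have "u = u' @ (t' @ v2)" using hv v u'(1) by (metis append_Cons append_assoc)
  then have "t' @ v2 = []" using first_passages_prefix[of u' "t' @ v2" Eo] u u'(2) by simp
  then have "u = h # v1" using hv v by simp
  then have "last u \<in> - Ed" using v1 by (auto simp: first_passages_def)
  then show False using u Eo_subset by (auto simp: first_passages_def)
qed

text \<open>
  The first state of \<open>Ed\<close> that is visited is already in \<open>Eo\<close>, so it is the end of the path.
\<close>
lemma first_passage_stays_outside:
  assumes u: "u \<in> first_passages Eo" and w: "path_weight p i u \<noteq> 0" and hd: "hd u \<notin> Ed"
  shows "set (butlast u) \<inter> Ed = {}"
proof -
  from u obtain h v where hv: "u = h # v" by (cases u) (auto simp: first_passages_def)
  have last: "last u \<in> Eo" using u by (auto simp: first_passages_def)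
  with hd hv Eo_subset have "v \<noteq> []" by auto
  then have "last v \<in> set v" "last v \<in> Ed" using last hv Eo_subset by auto
  then have "set v \<inter> Ed \<noteq> {}" by blast
  then obtain v1 v2 where v: "v = v1 @ v2" and v1: "v1 \<in> first_passages Ed"
    using first_passages_split by metis
  have h: "h \<notin> Ed" using hd hv by simp
  have "path_weight p h v1 \<noteq> 0" using w hv v by (auto simp: path_weight_append)
  then have "last v1 \<in> Eo" using enter_through_Eo[OF h v1] by auto
  then have "h # v1 \<in> first_passages Eo"
    using v1 h Eo_subset by (auto simp: first_passages_def)
  then have "v2 = []" using first_passages_prefix[of "h # v1" v2 Eo] u hv v by simp
  then show ?thesis using hv v v1 h by (auto simp: first_passages_def)
qed

text \<open>
  Paths that step into \<open>Ed\<close> and leave it later. They are cut at the first visit to \<open>Eo\<close>; since the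
  first piece lies in \<open>Ed\<close>, the exit takes place in the continuation.
\<close>
lemma path_sum_through_inside:
  assumes summ: "path_weight (step_weight p Ed x y) i summable_on paths_into i F"
  shows "((\<lambda>j. path_sum (step_weight p Ed x x) i {u \<in> first_passages Eo. hd u \<in> Ed \<and> last u = j} *
        path_sum (step_weight p Ed x y) j {t \<in> paths_into j F. set t \<inter> - Ed \<noteq> {}})
      has_sum path_sum (step_weight p Ed x y) i
        {s \<in> paths_into i F. s \<noteq> [] \<and> hd s \<in> Ed \<and> set s \<inter> - Ed \<noteq> {}}) Eo"
proof -
  let ?q = "step_weight p Ed x y"
  let ?P = "{s \<in> paths_into i F. s \<noteq> [] \<and> hd s \<in> Ed \<and> set s \<inter> - Ed \<noteq> {}}"
  let ?U = "{u \<in> first_passages Eo. hd u \<in> Ed}"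
  let ?T = "\<lambda>j. {t \<in> paths_into j F. set t \<inter> - Ed \<noteq> {}}"
  \<comment> \<open>The composite paths and the paths to be counted differ only by paths of weight zero.\<close>
  define C where "C = {u @ t | u t. u \<in> ?U \<and> t \<in> ?T (last u)}"
  have CP: "C \<subseteq> ?P"
  proof
    fix s assume "s \<in> C"
    then obtain u t where s: "s = u @ t" "u \<in> ?U" "t \<in> ?T (last u)" unfolding C_def by blast
    then have "u \<noteq> []" by (auto simp: first_passages_def)
    with s show "s \<in> ?P" by auto
  qed
  have PC: "path_weight ?q i s = 0" if s: "s \<in> ?P - C" for s
  proof (rule ccontr)
    assume "path_weight ?q i s \<noteq> 0"
    then have w: "path_weight p i s \<noteq> 0" by (auto simp: path_weight_step_weight)
    from s obtain h v where hv: "s = h # v" by (cases s) auto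
    have "set s \<inter> Eo \<noteq> {}"
    proof (cases "h \<in> Eo")
      case False
      with s hv have h: "h \<in> Ed - Eo" and "set v \<inter> - Ed \<noteq> {}" by auto
      then obtain v1 v2 where v: "v = v1 @ v2" and v1: "v1 \<in> first_passages (- Ed)"
        using first_passages_split by metis
      have "path_weight p h v1 \<noteq> 0" using w hv v by (auto simp: path_weight_append)
      then show ?thesis using exit_through_Eo[OF h v1] hv v by auto
    qed (use hv in auto)
    then obtain u t where ut: "s = u @ t" "u \<in> first_passages Eo"
      using first_passages_split by metis
    then have ne: "u \<noteq> []" by (auto simp: first_passages_def)
    then have hd: "hd u \<in> Ed" using s ut by auto
    have "path_weight p i u \<noteq> 0" using w ut by (auto simp: path_weight_append)
    then have "set u \<subseteq> Ed" using first_passage_stays_inside ut(2) hd by blast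
    then have "set t \<inter> - Ed \<noteq> {}" using s ut by auto
    moreover have "t \<in> paths_into (last u) F" using s ut ne by auto
    ultimately have "s \<in> C" unfolding C_def using ut hd by blast
    with s show False by simp
  qed
  have sumC: "path_weight ?q i summable_on C"
    using summ by (rule summable_on_subset_banach) (use CP in auto)
  have "path_sum ?q i C = path_sum ?q i ?P"
    unfolding path_sum_def by (rule infsum_cong_neutral) (use CP PC in auto)
  moreover have "((\<lambda>j. path_sum ?q i {u \<in> ?U. last u = j} * path_sum ?q j (?T j))
      has_sum path_sum ?q i C) Eo"
    by (rule path_sum_first_passage[OF _ C_def sumC]) auto
  moreover have "path_sum ?q i {u \<in> ?U. last u = j} =
      path_sum (step_weight p Ed x x) i {u \<in> first_passages Eo. hd u \<in> Ed \<and> last u = j}" for j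
    unfolding path_sum_def
  proof (rule infsum_cong_neutral)
    fix u assume "u \<in> {u \<in> ?U. last u = j} \<inter> {u \<in> first_passages Eo. hd u \<in> Ed \<and> last u = j}"
    then have "path_weight p i u = 0 \<or> set u \<subseteq> Ed"
      using first_passage_stays_inside by blast
    then show "path_weight ?q i u = path_weight (step_weight p Ed x x) i u"
    proof
      assume "set u \<subseteq> Ed"
      then have "filter (\<lambda>a. a \<notin> Ed) u = []" by (auto simp: filter_empty_conv)
      then show ?thesis by (simp add: path_weight_step_weight)
    qed (simp add: path_weight_step_weight)
  qed auto
  ultimately show ?thesis by simp
qed

text \<open>
  Exactly one step of such a path, the last one, lands in \<open>Ed\<close>: its weight has one factor \<open>x\<close> where
  the homogeneous weight has \<open>y\<close>.
\<close>
lemma path_sum_first_passage_from_outside: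
  assumes "y \<noteq> 0"
  shows "path_sum (step_weight p Ed x y) i {u \<in> first_passages Eo. hd u \<notin> Ed \<and> last u = j} =
    x / y * path_sum (step_weight p Ed y y) i {u \<in> first_passages Eo. hd u \<notin> Ed \<and> last u = j}"
proof -
  have "path_weight (step_weight p Ed x y) i u = x / y * path_weight (step_weight p Ed y y) i u"
    if u: "u \<in> first_passages Eo" "hd u \<notin> Ed" for u
  proof (cases "path_weight p i u = 0")
    case False
    have out: "set (butlast u) \<inter> Ed = {}"
      using first_passage_stays_outside[OF u(1) False u(2)] .
    have ne: "u \<noteq> []" and last: "last u \<in> Ed"
      using u Eo_subset by (auto simp: first_passages_def)
    have f: "filter (\<lambda>a. a \<in> Ed) (butlast u) = []" "filter (\<lambda>a. a \<notin> Ed) (butlast u) = butlast u"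
      using out by (auto simp: filter_empty_conv filter_id_conv)
    obtain v where v: "u = v @ [last u]" "butlast u = v"
      using append_butlast_last_id[OF ne] by metis
    have "filter (\<lambda>a. a \<in> Ed) u = [last u]" "filter (\<lambda>a. a \<notin> Ed) u = v"
      using f last v by (metis append_Nil filter.simps filter_append append_Nil2)+
    moreover have "length u = Suc (length v)" using v by (metis length_append_singleton)
    ultimately show ?thesis
      using assms by (simp add: path_weight_step_weight path_weight_step_weight_same)
  qed (simp add: path_weight_step_weight)
  then have "path_sum (step_weight p Ed x y) i {u \<in> first_passages Eo. hd u \<notin> Ed \<and> last u = j} =
      (\<Sum>\<^sub>\<infinity>u\<in>{u \<in> first_passages Eo. hd u \<notin> Ed \<and> last u = j}.
        x / y * path_weight (step_weight p Ed y y) i u)"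
    unfolding path_sum_def by (intro infsum_cong) auto
  then show ?thesis by (simp only: path_sum_def infsum_cmult_right')
qed

text \<open>
  Paths that step outside \<open>Ed\<close> and enter it later. They too are cut at the first visit to \<open>Eo\<close>; both
  sides have then been visited, so the continuation is arbitrary.
\<close>
lemma path_sum_through_outside:
  assumes summ: "path_weight (step_weight p Ed x y) i summable_on paths_into i F" and "y \<noteq> 0"
  shows "((\<lambda>j. x / y *
        path_sum (step_weight p Ed y y) i {u \<in> first_passages Eo. hd u \<notin> Ed \<and> last u = j} *
        path_sum (step_weight p Ed x y) j (paths_into j F))
      has_sum path_sum (step_weight p Ed x y) i
        {s \<in> paths_into i F. s \<noteq> [] \<and> hd s \<notin> Ed \<and> set s \<inter> Ed \<noteq> {}}) Eo"
proof -
  let ?q = "step_weight p Ed x y"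
  let ?P = "{s \<in> paths_into i F. s \<noteq> [] \<and> hd s \<notin> Ed \<and> set s \<inter> Ed \<noteq> {}}"
  let ?U = "{u \<in> first_passages Eo. hd u \<notin> Ed}"
  define C where "C = {u @ t | u t. u \<in> ?U \<and> t \<in> paths_into (last u) F}"
  have CP: "C \<subseteq> ?P"
  proof
    fix s assume "s \<in> C"
    then obtain u t where s: "s = u @ t" "u \<in> ?U" "t \<in> paths_into (last u) F"
      unfolding C_def by blast
    then have "u \<noteq> []" "last u \<in> Ed" using Eo_subset by (auto simp: first_passages_def)
    with s show "s \<in> ?P" by (auto dest: last_in_set)
  qed
  have PC: "path_weight ?q i s = 0" if s: "s \<in> ?P - C" for s
  proof (rule ccontr)
    assume "path_weight ?q i s \<noteq> 0"
    then have w: "path_weight p i s \<noteq> 0" by (auto simp: path_weight_step_weight)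
    from s obtain h v where hv: "s = h # v" by (cases s) auto
    with s have h: "h \<notin> Ed" and "set v \<inter> Ed \<noteq> {}" by auto
    then obtain v1 v2 where v: "v = v1 @ v2" and v1: "v1 \<in> first_passages Ed"
      using first_passages_split by metis
    have "path_weight p h v1 \<noteq> 0" using w hv v by (auto simp: path_weight_append)
    then have "last v1 \<in> Eo" using enter_through_Eo[OF h v1] by simp
    moreover have "last v1 \<in> set s" using v1 hv v by (auto simp: first_passages_def)
    ultimately have "set s \<inter> Eo \<noteq> {}" by blast
    then obtain u t where ut: "s = u @ t" "u \<in> first_passages Eo"
      using first_passages_split by metis
    then have ne: "u \<noteq> []" by (auto simp: first_passages_def)
    then have "hd u \<notin> Ed" "t \<in> paths_into (last u) F" using s ut by auto
    then have "s \<in> C" unfolding C_def using ut by blast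
    with s show False by simp
  qed
  have sumC: "path_weight ?q i summable_on C"
    using summ by (rule summable_on_subset_banach) (use CP in auto)
  have "path_sum ?q i C = path_sum ?q i ?P"
    unfolding path_sum_def by (rule infsum_cong_neutral) (use CP PC in auto)
  moreover have "((\<lambda>j. path_sum ?q i {u \<in> ?U. last u = j} * path_sum ?q j (paths_into j F))
      has_sum path_sum ?q i C) Eo"
    by (rule path_sum_first_passage[OF _ C_def sumC]) auto
  moreover have "{u \<in> ?U. last u = j} = {u \<in> first_passages Eo. hd u \<notin> Ed \<and> last u = j}" for j
    by auto
  ultimately show ?thesis
    using path_sum_first_passage_from_outside[OF assms(2), where x = x] by simp
qed

text \<open>
  The main equation for arbitrary kernels. The two families \<open>a j * (k j - k0 j)\<close> and
  \<open>x / y * b j * k j\<close> are summable because they arise from regrouping an absolutely convergent sum.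
  The assumptions \<open>summ1\<close> and \<open>summ2\<close> are about the same terms arranged as in the conclusion.
\<close>
lemma path_sum_gateway:
  fixes F :: "'s set" and x y :: real and i :: 's
  defines "k \<equiv> \<lambda>j. path_sum (step_weight p Ed x y) j (paths_into j F)"
    and "k0 \<equiv> \<lambda>j. path_sum (step_weight p Ed x 0) j (paths_into j F)"
    and "a \<equiv> \<lambda>j. path_sum (step_weight p Ed x x) i {u \<in> first_passages Eo. hd u \<in> Ed \<and> last u = j}"
    and "b \<equiv> \<lambda>j. path_sum (step_weight p Ed y y) i {u \<in> first_passages Eo. hd u \<notin> Ed \<and> last u = j}"
  assumes "y \<noteq> 0"
    and summ: "\<And>j. j \<in> insert i Eo \<Longrightarrow>
      path_weight (step_weight p Ed x y) j summable_on paths_into j F"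
    and summ1: "(\<lambda>j. (a j + x / y * b j) * k j) summable_on Eo"
    and summ2: "(\<lambda>j. a j * k0 j) summable_on Eo"
  shows "k i = k0 i + path_sum (step_weight p Ed 0 y) i (paths_into i F)
    + (\<Sum>\<^sub>\<infinity>j\<in>Eo. (a j + x / y * b j) * k j) - (\<Sum>\<^sub>\<infinity>j\<in>Eo. a j * k0 j) - indicator F i"
proof -
  let ?q = "step_weight p Ed x y"
  let ?I = "paths_into i F"
  let ?P1 = "{s \<in> ?I. set s \<inter> - Ed = {}}"
  let ?P2 = "{s \<in> ?I. s \<noteq> [] \<and> set s \<inter> Ed = {}}"
  let ?P3 = "{s \<in> ?I. s \<noteq> [] \<and> hd s \<in> Ed \<and> set s \<inter> - Ed \<noteq> {}}"
  let ?P4 = "{s \<in> ?I. s \<noteq> [] \<and> hd s \<notin> Ed \<and> set s \<inter> Ed \<noteq> {}}"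
  have sub: "path_weight ?q i summable_on S" if "S \<subseteq> ?I" for S
    using summ[of i] that by (auto intro: summable_on_subset_banach)
  have hd_in: "hd s \<in> set s" if "s \<noteq> []" for s :: "'s list"
    using that by simp
  have "?I = (?P1 \<union> ?P2) \<union> (?P3 \<union> ?P4)"
    by (rule set_eqI) auto
  then have "k i = path_sum ?q i ((?P1 \<union> ?P2) \<union> (?P3 \<union> ?P4))"
    unfolding k_def by (rule arg_cong)
  also have "\<dots> = path_sum ?q i (?P1 \<union> ?P2) + path_sum ?q i (?P3 \<union> ?P4)"
    by (intro path_sum_Un_disjoint sub) (auto dest: hd_in)
  also have "path_sum ?q i (?P1 \<union> ?P2) = path_sum ?q i ?P1 + path_sum ?q i ?P2"
    by (intro path_sum_Un_disjoint sub) (auto dest: hd_in)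
  also have "path_sum ?q i (?P3 \<union> ?P4) = path_sum ?q i ?P3 + path_sum ?q i ?P4"
    by (intro path_sum_Un_disjoint sub) auto
  also have "path_sum ?q i ?P1 = k0 i"
    unfolding k0_def by (rule path_sum_step_weight_inside[symmetric])
  also have "path_sum ?q i ?P2 =
      path_sum (step_weight p Ed 0 y) i ?I - indicator F i"
  proof -
    have "path_sum (step_weight p Ed 0 y) i ?I =
        path_sum ?q i (?P2 \<union> (?I \<inter> {[]}))"
      unfolding path_sum_step_weight_outside[where x = x]
      by (rule arg_cong[where f = "path_sum ?q i"]) auto
    also have "\<dots> = path_sum ?q i ?P2 + path_sum ?q i (?I \<inter> {[]})"
      by (intro path_sum_Un_disjoint sub) auto
    also have "?I \<inter> {[]} = (if i \<in> F then {[]} else {})"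
      by (auto simp: paths_into_def)
    finally show ?thesis by (auto simp: indicator_def)
  qed
  also have "path_sum ?q i ?P3 + path_sum ?q i ?P4 =
      (\<Sum>\<^sub>\<infinity>j\<in>Eo. (a j + x / y * b j) * k j) - (\<Sum>\<^sub>\<infinity>j\<in>Eo. a j * k0 j)"
  proof -
    have diff: "path_sum ?q j {t \<in> paths_into j F. set t \<inter> - Ed \<noteq> {}} = k j - k0 j" if "j \<in> Eo" for j
    proof -
      have sj: "path_weight ?q j summable_on S" if "S \<subseteq> paths_into j F" for S
        using summ[of j] \<open>j \<in> Eo\<close> that by (auto intro: summable_on_subset_banach)
      have "k j = path_sum ?q j ({t \<in> paths_into j F. set t \<inter> - Ed \<noteq> {}} \<union>
          {t \<in> paths_into j F. set t \<inter> - Ed = {}})"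
        unfolding k_def by (rule arg_cong[where f = "path_sum ?q j"]) auto
      also have "\<dots> = path_sum ?q j {t \<in> paths_into j F. set t \<inter> - Ed \<noteq> {}} + k0 j"
        unfolding k0_def path_sum_step_weight_inside[where y = y]
        by (intro path_sum_Un_disjoint sj) auto
      finally show ?thesis by simp
    qed
    have "((\<lambda>j. a j * (k j - k0 j)) has_sum path_sum ?q i ?P3) Eo"
      using path_sum_through_inside[OF summ[of i]] unfolding a_def
      by (rule has_sum_cong[THEN iffD1, rotated]) (use diff in auto)
    moreover have "((\<lambda>j. x / y * b j * k j) has_sum path_sum ?q i ?P4) Eo"
      using path_sum_through_outside[OF summ[of i] \<open>y \<noteq> 0\<close>] unfolding b_def k_def by simp
    ultimately have "((\<lambda>j. a j * (k j - k0 j) + x / y * b j * k j)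
        has_sum path_sum ?q i ?P3 + path_sum ?q i ?P4) Eo"
      by (rule has_sum_add)
    moreover have "((\<lambda>j. (a j + x / y * b j) * k j + - (a j * k0 j)) has_sum
        (\<Sum>\<^sub>\<infinity>j\<in>Eo. (a j + x / y * b j) * k j) + - (\<Sum>\<^sub>\<infinity>j\<in>Eo. a j * k0 j)) Eo"
      by (intro has_sum_add has_sum_uminusI has_sum_infsum summ1 summ2)
    moreover have "(\<lambda>j. (a j + x / y * b j) * k j + - (a j * k0 j)) =
        (\<lambda>j. a j * (k j - k0 j) + x / y * b j * k j)"
      by (auto simp: algebra_simps)
    ultimately show ?thesis
      using has_sum_unique by fastforce
  qed
  finally show ?thesis by simp
qed

end

section \<open>Kernels dominated by a stochastic kernel\<close>

text \<open>
  Stochasticity is expressed on paths of every length, the form in which the law of a chain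
  provides it and in which it is used.
\<close>
locale stochastic_kernel =
  fixes p :: "'s \<Rightarrow> 's \<Rightarrow> real"
  assumes kernel_nonneg: "0 \<le> p i j"
    and paths_of_length: "(path_weight p i has_sum 1) {s. length s = n}"

text \<open>
  The kernels \<open>step_weight p A x y\<close> with \<open>\<bar>x\<bar>\<close> and \<open>\<bar>y\<bar>\<close> less than one are of this kind; all their
  path sums converge and are bounded by a geometric series over the length of the path.
\<close>
locale dominated_kernel = stochastic_kernel +
  fixes q :: "'s \<Rightarrow> 's \<Rightarrow> real" and r :: real
  assumes r: "0 \<le> r" "r < 1" and dominated: "\<bar>q a b\<bar> \<le> r * p a b"
begin

lemma path_weight_dominated: "\<bar>path_weight q i s\<bar> \<le> path_weight p i s * r ^ length s"
proof (induction s arbitrary: i)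
  case (Cons a s)
  have "\<bar>q i a\<bar> * \<bar>path_weight q a s\<bar> \<le> (r * p i a) * (path_weight p a s * r ^ length s)"
    by (intro mult_mono dominated Cons) (use r kernel_nonneg in auto)
  then show ?case by (simp add: abs_mult mult_ac)
qed simp

lemma abs_path_weight_summable: "(\<lambda>s. \<bar>path_weight q i s\<bar>) summable_on UNIV"
  and abs_path_weight_bound: "(\<Sum>\<^sub>\<infinity>s. \<bar>path_weight q i s\<bar>) \<le> 1 / (1 - r)"
proof -
  have geo: "((\<lambda>n. r ^ n) has_sum 1 / (1 - r)) UNIV"
    using r by (intro norm_summable_imp_has_sum geometric_sums) (auto simp: summable_geometric)
  have nn: "0 \<le> path_weight p i s" for s
    by (intro path_weight_nonneg kernel_nonneg)
  have len: "path_weight p i summable_on {s. length s = n}"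
      "(\<Sum>\<^sub>\<infinity>s\<in>{s. length s = n}. path_weight p i s) = 1" for n
    using paths_of_length[of i n] by (auto simp: has_sum_iff)
  have sm: "(\<lambda>s. path_weight p i s * r ^ length s) summable_on UNIV"
    using summable_on_fibers_iff(1)[of UNIV "path_weight p i" UNIV length "\<lambda>n. r ^ n"]
      nn len has_sum_imp_summable[OF geo] by simp
  have eq: "(\<Sum>\<^sub>\<infinity>s. path_weight p i s * r ^ length s) = 1 / (1 - r)"
    using summable_on_fibers_iff(2)[of UNIV "path_weight p i" UNIV length "\<lambda>n. r ^ n"]
      nn len infsumI[OF geo] by simp
  show *: "(\<lambda>s. \<bar>path_weight q i s\<bar>) summable_on UNIV"
    using sm path_weight_dominated by (intro summable_on_comparison_test[OF sm]) auto
  show "(\<Sum>\<^sub>\<infinity>s. \<bar>path_weight q i s\<bar>) \<le> 1 / (1 - r)"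
    unfolding eq[symmetric] by (intro infsum_mono * sm path_weight_dominated)
qed

lemma path_weight_summable: "path_weight q i summable_on S"
  using summable_on_subset_banach[OF abs_path_weight_summable[of i] subset_UNIV[of S]]
  by (simp add: summable_on_abs_iff)

lemma abs_path_sum_le: "\<bar>path_sum q i S\<bar> \<le> path_sum (\<lambda>a b. \<bar>q a b\<bar>) i S"
  unfolding path_sum_def path_weight_abs
  using norm_infsum_bound[of "path_weight q i" S] path_weight_summable[of i S]
  by (simp add: summable_on_abs_iff)

lemma path_sum_abs_le: "path_sum (\<lambda>a b. \<bar>q a b\<bar>) i S \<le> 1 / (1 - r)"
proof -
  have "path_sum (\<lambda>a b. \<bar>q a b\<bar>) i S \<le> (\<Sum>\<^sub>\<infinity>s. \<bar>path_weight q i s\<bar>)"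
    unfolding path_sum_def path_weight_abs
    by (rule infsum_mono2)
       (auto intro: abs_path_weight_summable summable_on_subset_banach[OF abs_path_weight_summable])
  also note abs_path_weight_bound
  finally show ?thesis .
qed

lemma dominated_kernel_abs: "dominated_kernel p (\<lambda>a b. \<bar>q a b\<bar>) r"
  by unfold_locales (use r dominated in auto)

text \<open>
  With \<open>g\<close> and \<open>h\<close> the matrices of Green functions and first-passage sums on \<open>A\<close>, the last-passage
  decomposition reads \<open>g - g h = I\<close>. Hence \<open>d = d g - (d g) h\<close>, which vanishes with \<open>d g\<close>. The only
  analytic point is the associativity \<open>d (g h) = (d g) h\<close>, an exchange of two infinite sums.
\<close>
lemma green_function_injective:
  assumes d: "d summable_on A" and "j \<in> A"
    and zero: "\<And>l. l \<in> A \<Longrightarrow> (\<Sum>\<^sub>\<infinity>k\<in>A. d k * path_sum q k (paths_into k {l})) = 0"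
  shows "d j = 0"
proof -
  define g where "g k l = path_sum q k (paths_into k {l})" for k l
  define h where "h l = path_sum q l {u \<in> first_passages A. last u = j}" for l
  define B where "B = 1 / (1 - r)"
  have B: "0 \<le> B" using r by (simp add: B_def)
  have abs_d: "(\<lambda>k. \<bar>d k\<bar>) summable_on A"
    using d by (simp add: summable_on_abs_iff)
  have last: "((\<lambda>l. g k l * h l) has_sum g k j - (if k = j then 1 else 0)) A" if "k \<in> A" for k
    unfolding g_def h_def by (rule path_sum_last_passage[OF that \<open>j \<in> A\<close> path_weight_summable])
  \<comment> \<open>The last-passage decomposition for the kernel \<open>\<bar>q\<bar>\<close> bounds the rows of \<open>\<bar>g\<bar> \<bar>h\<bar>\<close> uniformly
    in \<open>k\<close>, which is what makes the double series absolutely convergent.\<close>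
  have row: "(\<lambda>l. \<bar>g k l * h l\<bar>) summable_on A" "(\<Sum>\<^sub>\<infinity>l\<in>A. \<bar>g k l * h l\<bar>) \<le> B" if "k \<in> A" for k
  proof -
    interpret abs: dominated_kernel p "\<lambda>a b. \<bar>q a b\<bar>" r by (rule dominated_kernel_abs)
    let ?G = "\<lambda>l. path_sum (\<lambda>a b. \<bar>q a b\<bar>) k (paths_into k {l})"
    let ?H = "\<lambda>l. path_sum (\<lambda>a b. \<bar>q a b\<bar>) l {u \<in> first_passages A. last u = j}"
    have hs: "((\<lambda>l. ?G l * ?H l) has_sum ?G j - (if k = j then 1 else 0)) A"
      by (rule path_sum_last_passage[OF that \<open>j \<in> A\<close> abs.path_weight_summable])
    have le: "\<bar>g k l * h l\<bar> \<le> ?G l * ?H l" for l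
      unfolding abs_mult g_def h_def
      by (intro mult_mono abs_path_sum_le abs_ge_zero order_trans[OF abs_ge_zero abs_path_sum_le])
    show sm: "(\<lambda>l. \<bar>g k l * h l\<bar>) summable_on A"
      by (rule summable_on_comparison_test[OF has_sum_imp_summable[OF hs]]) (use le in auto)
    have "(\<Sum>\<^sub>\<infinity>l\<in>A. \<bar>g k l * h l\<bar>) \<le> (\<Sum>\<^sub>\<infinity>l\<in>A. ?G l * ?H l)"
      by (intro infsum_mono sm has_sum_imp_summable[OF hs] le)
    also have "\<dots> \<le> ?G j" unfolding infsumI[OF hs] by simp
    also have "\<dots> \<le> B" unfolding B_def by (rule path_sum_abs_le)
    finally show "(\<Sum>\<^sub>\<infinity>l\<in>A. \<bar>g k l * h l\<bar>) \<le> B" .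
  qed
  have double: "(\<lambda>(k, l). d k * (g k l * h l)) summable_on A \<times> A"
  proof -
    have "(\<lambda>z. norm (case z of (k, l) \<Rightarrow> d k * (g k l * h l))) summable_on A \<times> A"
      unfolding Infinite_Sum.abs_summable_on_Sigma_iff
    proof (intro conjI ballI)
      fix k assume "k \<in> A"
      then show "(\<lambda>l. norm (case (k, l) of (k, l) \<Rightarrow> d k * (g k l * h l))) summable_on A"
        using summable_on_cmult_right[OF row(1), of k "\<bar>d k\<bar>"] by (simp add: abs_mult mult_ac)
    next
      have "(\<lambda>k. \<bar>d k\<bar> * (\<Sum>\<^sub>\<infinity>l\<in>A. \<bar>g k l * h l\<bar>)) summable_on A"
      proof (rule summable_on_comparison_test)
        show "(\<lambda>k. \<bar>d k\<bar> * B) summable_on A" by (intro summable_on_cmult_left abs_d)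
        show "\<bar>d k\<bar> * (\<Sum>\<^sub>\<infinity>l\<in>A. \<bar>g k l * h l\<bar>) \<le> \<bar>d k\<bar> * B" if "k \<in> A" for k
          by (intro mult_left_mono row that) auto
        show "0 \<le> \<bar>d k\<bar> * (\<Sum>\<^sub>\<infinity>l\<in>A. \<bar>g k l * h l\<bar>)" for k
          by (intro mult_nonneg_nonneg infsum_nonneg) auto
      qed
      then have "(\<lambda>k. \<Sum>\<^sub>\<infinity>l\<in>A. \<bar>d k * (g k l * h l)\<bar>) summable_on A"
        by (subst abs_mult) (simp add: infsum_cmult_right')
      then show "(\<lambda>k. norm (\<Sum>\<^sub>\<infinity>l\<in>A. norm (case (k, l) of (k, l) \<Rightarrow> d k * (g k l * h l)))) summable_on A"
        by (simp add: summable_on_abs_iff)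
    qed
    then show ?thesis by (simp add: summable_on_abs_iff case_prod_unfold)
  qed
  have "(\<Sum>\<^sub>\<infinity>k\<in>A. \<Sum>\<^sub>\<infinity>l\<in>A. d k * (g k l * h l)) = (\<Sum>\<^sub>\<infinity>l\<in>A. \<Sum>\<^sub>\<infinity>k\<in>A. d k * (g k l * h l))"
    by (rule infsum_swap_banach[OF double])
  also have "\<dots> = (\<Sum>\<^sub>\<infinity>l\<in>A. (\<Sum>\<^sub>\<infinity>k\<in>A. d k * g k l) * h l)"
    by (simp add: infsum_cmult_left'[symmetric] mult.assoc)
  also have "\<dots> = 0"
    by (rule infsum_0) (simp add: g_def zero)
  also have "(\<Sum>\<^sub>\<infinity>k\<in>A. \<Sum>\<^sub>\<infinity>l\<in>A. d k * (g k l * h l)) =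
      (\<Sum>\<^sub>\<infinity>k\<in>A. d k * g k j + - (if k = j then d j else 0))"
  proof (rule infsum_cong)
    fix k assume "k \<in> A"
    have "(\<Sum>\<^sub>\<infinity>l\<in>A. d k * (g k l * h l)) = d k * (g k j - (if k = j then 1 else 0))"
      by (simp add: infsum_cmult_right' infsumI[OF last[OF \<open>k \<in> A\<close>]])
    then show "(\<Sum>\<^sub>\<infinity>l\<in>A. d k * (g k l * h l)) = d k * g k j + - (if k = j then d j else 0)"
      by (auto simp: algebra_simps)
  qed
  also have "\<dots> = 0 + - d j"
  proof (rule infsumI, rule has_sum_add)
    have "(\<lambda>k. \<bar>d k * g k j\<bar>) summable_on A"
    proof (rule summable_on_comparison_test)
      show "(\<lambda>k. \<bar>d k\<bar> * B) summable_on A" by (intro summable_on_cmult_left abs_d)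
      show "\<bar>d k * g k j\<bar> \<le> \<bar>d k\<bar> * B" for k
        unfolding abs_mult g_def B_def
        by (intro mult_left_mono order_trans[OF abs_path_sum_le path_sum_abs_le]) auto
    qed auto
    then have "(\<lambda>k. d k * g k j) summable_on A"
      by (simp add: summable_on_abs_iff)
    then show "((\<lambda>k. d k * g k j) has_sum 0) A"
      using zero[OF \<open>j \<in> A\<close>] by (simp add: has_sum_iff g_def)
    show "((\<lambda>k. - (if k = j then d j else 0)) has_sum - d j) A"
      by (rule has_sum_finite_neutralI[of "{j}"]) (use \<open>j \<in> A\<close> in auto)
  qed
  finally show ?thesis by simp
qed

end

lemma (in dominated_kernel) abs_path_sum_bound: "\<bar>path_sum q i S\<bar> \<le> 1 / (1 - r)"
  by (rule order_trans[OF abs_path_sum_le path_sum_abs_le])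

lemma (in dominated_kernel) passage_sums_summable:
  "(\<lambda>j. \<bar>path_sum q i {u \<in> first_passages A. hd u \<in> V \<and> last u = j}\<bar>) summable_on A"
proof -
  have eq: "{u \<in> {u \<in> first_passages A. hd u \<in> V}. last u = j} =
      {u \<in> first_passages A. hd u \<in> V \<and> last u = j}" for j by auto
  have "(\<lambda>j. path_sum q i {u \<in> first_passages A. hd u \<in> V \<and> last u = j}) summable_on A"
    using has_sum_imp_summable[OF has_sum_fibers[OF path_weight_summable[of i
      "{u \<in> first_passages A. hd u \<in> V}"], of last A]]
    unfolding eq path_sum_def by (auto simp: first_passages_def)
  then show ?thesis by (simp add: summable_on_abs_iff)
qed

lemma (in stochastic_kernel) step_weight_dominated:
  assumes "\<bar>x\<bar> < 1" "\<bar>y\<bar> < 1"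
  shows "dominated_kernel p (step_weight p A x y) (max \<bar>x\<bar> \<bar>y\<bar>)"
proof
  fix a b
  have "\<bar>if b \<in> A then x else y\<bar> \<le> max \<bar>x\<bar> \<bar>y\<bar>" by auto
  from mult_left_mono[OF this, of "p a b"]
  show "\<bar>step_weight p A x y a b\<bar> \<le> max \<bar>x\<bar> \<bar>y\<bar> * p a b"
    using kernel_nonneg[of a b] by (simp add: step_weight_def abs_mult mult.commute)
qed (use assms in auto)

lemma (in stochastic_kernel) kernel_row_summable: "(\<lambda>k. \<bar>p i k\<bar>) summable_on B"
proof -
  have "{s. length s = Suc 0} = range (\<lambda>k :: 's. [k])"
    by (auto simp: length_Suc_conv)
  then have "path_weight p i summable_on range (\<lambda>k. [k])"
    using has_sum_imp_summable[OF paths_of_length[of i "Suc 0"]] by simp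
  then have "(\<lambda>k. p i k) summable_on UNIV"
    by (subst (asm) summable_on_reindex) (auto simp: inj_def o_def)
  then have "(\<lambda>k. p i k) summable_on B" by (rule summable_on_subset_banach) auto
  then show ?thesis by (simp add: summable_on_abs_iff)
qed

section \<open>Hitting times, sojourn times and trajectories\<close>

text \<open>
  The law of \<open>Z\<close> has a density with respect to counting measure, so the Bochner integral is an
  absolutely convergent sum over the values of \<open>Z\<close>.
\<close>
lemma (in prob_space) expectation_discrete:
  fixes Z :: "'a \<Rightarrow> 'z::countable" and g :: "'z \<Rightarrow> real"
  assumes [measurable]: "Z \<in> measurable M (count_space UNIV)"
  shows "integrable M (\<lambda>w. g (Z w)) \<longleftrightarrow> (\<lambda>z. \<P>(w in M. Z w = z) * g z) summable_on UNIV"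
    and "expectation (\<lambda>w. g (Z w)) = (\<Sum>\<^sub>\<infinity>z. \<P>(w in M. Z w = z) * g z)"
proof -
  let ?pr = "\<lambda>z. \<P>(w in M. Z w = z)"
  have D: "distr M (count_space UNIV) Z = density (count_space UNIV) (\<lambda>z. ennreal (?pr z))"
  proof (rule measure_eqI_countable[where A = UNIV])
    fix a
    have "emeasure (distr M (count_space UNIV) Z) {a} = emeasure M (Z -` {a} \<inter> space M)"
      by (simp add: emeasure_distr)
    also have "Z -` {a} \<inter> space M = {w \<in> space M. Z w = a}" by auto
    finally show "emeasure (distr M (count_space UNIV) Z) {a} =
        emeasure (density (count_space UNIV) (\<lambda>z. ennreal (?pr z))) {a}"
      by (simp add: emeasure_density emeasure_eq_measure nn_integral_indicator_singleton)
  qed auto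
  have sm: "integrable (count_space UNIV) (\<lambda>z. ?pr z * g z) \<longleftrightarrow> (\<lambda>z. ?pr z * g z) summable_on UNIV"
    using abs_summable_equivalent[of "\<lambda>z. ?pr z * g z" UNIV]
    by (simp add: Infinite_Set_Sum.abs_summable_on_def summable_on_abs_iff del: abs_mult)
  have "integrable M (\<lambda>w. g (Z w)) \<longleftrightarrow> integrable (distr M (count_space UNIV) Z) g"
    by (subst integrable_distr_eq) auto
  also have "\<dots> \<longleftrightarrow> integrable (count_space UNIV) (\<lambda>z. ?pr z * g z)"
    unfolding D by (subst integrable_density) auto
  finally show iff: "integrable M (\<lambda>w. g (Z w)) \<longleftrightarrow> (\<lambda>z. ?pr z * g z) summable_on UNIV"
    using sm by simp
  have "expectation (\<lambda>w. g (Z w)) = integral\<^sup>L (distr M (count_space UNIV) Z) g"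
    by (subst integral_distr) auto
  also have "\<dots> = integral\<^sup>L (count_space UNIV) (\<lambda>z. ?pr z * g z)"
    unfolding D by (subst integral_density) auto
  also have "\<dots> = (\<Sum>\<^sub>\<infinity>z. ?pr z * g z)"
  proof (cases "(\<lambda>z. ?pr z * g z) summable_on UNIV")
    case True
    then show ?thesis
      using infsetsum_infsum[of "\<lambda>z. ?pr z * g z" UNIV] sm
      by (simp add: Infinite_Set_Sum.abs_summable_on_def infsetsum_def)
  next
    case False
    then show ?thesis using sm by (simp add: infsum_not_exists not_integrable_integral_eq)
  qed
  finally show "expectation (\<lambda>w. g (Z w)) = (\<Sum>\<^sub>\<infinity>z. ?pr z * g z)" .
qed

lemma hit_eq_enat_iff:
  "hit X A w = enat n \<longleftrightarrow> 1 \<le> n \<and> X n w \<in> A \<and> (\<forall>m. 1 \<le> m \<and> m < n \<longrightarrow> X m w \<notin> A)" (is "_ \<longleftrightarrow> ?first n")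
proof -
  have first: "hit X A w = enat n" if "?first n" for n
    unfolding hit_def
  proof (rule antisym)
    show "(INF m\<in>{m. 1 \<le> m \<and> X m w \<in> A}. enat m) \<le> enat n"
      by (rule INF_lower) (use that in auto)
    show "enat n \<le> (INF m\<in>{m. 1 \<le> m \<and> X m w \<in> A}. enat m)"
      by (rule INF_greatest) (use that in \<open>auto simp: not_less[symmetric]\<close>)
  qed
  show ?thesis
  proof
    assume hit: "hit X A w = enat n"
    have "\<exists>m. 1 \<le> m \<and> X m w \<in> A"
    proof (rule ccontr)
      assume "\<nexists>m. 1 \<le> m \<and> X m w \<in> A"
      then have "{m. 1 \<le> m \<and> X m w \<in> A} = {}" by blast
      then have "hit X A w = \<infinity>"
        unfolding hit_def by (simp only: image_empty Inf_empty top_enat_def)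
      with hit show False by simp
    qed
    then obtain m where "?first m"
      using exists_least_iff[of "\<lambda>m. 1 \<le> m \<and> X m w \<in> A"] by blast
    with first[of m] hit show "?first n" by simp
  qed (use first in auto)
qed

definition trajectory :: "(nat \<Rightarrow> 'w \<Rightarrow> 's) \<Rightarrow> nat \<Rightarrow> 'w \<Rightarrow> 's list" where
  "trajectory X n w = map (\<lambda>m. X m w) [1..<Suc n]"

lemma length_trajectory [simp]: "length (trajectory X n w) = n"
  by (simp add: trajectory_def)

lemma trajectory_eq_iff:
  "trajectory X n w = s \<longleftrightarrow> length s = n \<and> (\<forall>m<n. X (Suc m) w = s ! m)"
  by (auto simp: trajectory_def list_eq_iff_nth_eq simp del: upt_Suc)

lemma trajectory_Suc: "trajectory X (Suc n) w = trajectory X n w @ [X (Suc n) w]"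
  by (simp add: trajectory_def)

lemma set_trajectory: "set (trajectory X n w) = {X m w | m. 1 \<le> m \<and> m \<le> n}"
  by (auto simp: trajectory_def simp del: upt_Suc)

lemma hd_trajectory: "0 < n \<Longrightarrow> hd (trajectory X n w) = X 1 w"
  by (simp add: trajectory_def hd_map upt_conv_Cons del: upt_Suc)

text \<open>Hitting times and paths both ignore the state at time \<open>0\<close>, which is why the two notions agree.\<close>
lemma trajectory_first_passage_iff:
  "trajectory X n w \<in> first_passages A \<longleftrightarrow> hit X A w = enat n"
proof (cases n)
  case 0
  then show ?thesis by (auto simp: hit_eq_enat_iff first_passages_def trajectory_def)
next
  case (Suc k)
  show ?thesis
    unfolding Suc hit_eq_enat_iff first_passages_def
    by (auto simp: trajectory_Suc set_trajectory less_Suc_eq_le)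
qed

lemma sojourn_trajectory: "sojourn X A n w = length (filter (\<lambda>a. a \<in> A) (trajectory X n w))"
proof -
  have "length (filter (\<lambda>a. a \<in> A) (trajectory X n w)) =
      card ({m. X m w \<in> A} \<inter> set [1..<Suc n])"
    by (simp add: trajectory_def filter_map o_def distinct_length_filter del: upt_Suc)
  also have "{m. X m w \<in> A} \<inter> set [1..<Suc n] = {m \<in> {1..n}. X m w \<in> A}"
    by auto
  finally show ?thesis by (simp add: sojourn_def)
qed

section \<open>The law of a Markov chain as a weight on paths\<close>

context homogeneous_markov_chain
begin

abbreviation "p \<equiv> trans_prob P X"

lemma measurable_X_eq [measurable]: "Measurable.pred (P i) (\<lambda>w. X m w = a)"
  using measurable_X[of m i] by measurable

text \<open>
  The product formula for finite-dimensional distributions, by induction on the last step. When the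
  history has probability zero, the conditional probability gives no information, but then
  both sides vanish.
\<close>
lemma prob_path: "\<P>(w in P i. \<forall>m\<le>length s. X m w = (i # s) ! m) = path_weight p i s"
proof (induction s rule: rev_induct)
  case Nil
  interpret prob_space "P i" by (rule prob_space_P)
  show ?case using start[of i] by (simp add: prob_Collect_eq_1)
next
  case (snoc a s)
  interpret prob_space "P i" by (rule prob_space_P)
  let ?h = "\<lambda>w. \<forall>m\<le>length s. X m w = (i # s) ! m"
  have ev: "(\<forall>m\<le>length (s @ [a]). X m w = (i # s @ [a]) ! m) \<longleftrightarrow> X (Suc (length s)) w = a \<and> ?h w" for w
  proof -
    have "(i # s @ [a]) ! m = (i # s) ! m" if "m \<le> length s" for m
      using that by (cases m) (auto simp: nth_append)
    then show ?thesis by (auto simp: le_Suc_eq)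
  qed
  have last: "(i # s) ! length s = last (i # s)"
    by (simp add: last_conv_nth)
  have "\<P>(w in P i. X (Suc (length s)) w = a \<and> ?h w) = path_weight p i s * p (last (i # s)) a"
  proof (cases "\<P>(w in P i. ?h w) = 0")
    case True
    have "\<P>(w in P i. X (Suc (length s)) w = a \<and> ?h w) \<le> \<P>(w in P i. ?h w)"
      by (rule finite_measure_mono) auto
    with True have "\<P>(w in P i. X (Suc (length s)) w = a \<and> ?h w) = 0"
      by (intro antisym) simp_all
    then show ?thesis using True snoc by simp
  next
    case False
    from markov[OF False, of a] last snoc False show ?thesis
      by (simp add: cond_prob_def field_simps)
  qed
  then show ?case by (simp only: ev path_weight_append) simp
qed

lemma measurable_trajectory [measurable]: "trajectory X n \<in> measurable (P i) (count_space UNIV)"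
  unfolding measurable_count_space_eq2_countable
proof (intro conjI ballI)
  fix s :: "'s list"
  have "trajectory X n -` {s} \<inter> space (P i) =
      {w \<in> space (P i). trajectory X n w = s}"
    by auto
  also have "\<dots> \<in> sets (P i)" unfolding trajectory_eq_iff by measurable
  finally show "trajectory X n -` {s} \<inter> space (P i) \<in> sets (P i)" .
qed auto

lemma prob_trajectory:
  "\<P>(w in P i. trajectory X n w = s) = (if length s = n then path_weight p i s else 0)"
proof (cases "length s = n")
  case True
  interpret prob_space "P i" by (rule prob_space_P)
  have "\<P>(w in P i. trajectory X n w = s) = \<P>(w in P i. \<forall>m\<le>length s. X m w = (i # s) ! m)"
  proof (rule prob_eq_AE)
    show "AE w in P i. trajectory X n w = s \<longleftrightarrow> (\<forall>m\<le>length s. X m w = (i # s) ! m)"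
      using start[of i]
    proof eventually_elim
      case (elim w)
      have "(\<forall>m\<le>n. X m w = (i # s) ! m) \<longleftrightarrow> (\<forall>m<n. X (Suc m) w = s ! m)"
        using elim by (auto simp: nth_Cons split: nat.splits)
      then show ?case using True by (simp add: trajectory_eq_iff)
    qed
  qed measurable
  with True prob_path[of i s] show ?thesis by simp
next
  case False
  then have "trajectory X n w \<noteq> s" for w by (metis length_trajectory)
  then show ?thesis using False by simp
qed

lemma path_weight_length_summable: "path_weight p i summable_on {s. length s = n}"
  and prob_trajectory_event:
    "\<P>(w in P i. trajectory X n w \<in> S) = (\<Sum>\<^sub>\<infinity>s\<in>{s \<in> S. length s = n}. path_weight p i s)"
proof -
  interpret prob_space "P i" by (rule prob_space_P)
  have "(\<lambda>s. (if length s = n then path_weight p i s else 0) * 1) summable_on UNIV"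
    using expectation_discrete(1)[OF measurable_trajectory, of "\<lambda>_. 1" n]
    unfolding prob_trajectory by simp
  then show "path_weight p i summable_on {s. length s = n}"
    by (rule summable_on_cong_neutral[THEN iffD1, rotated -1]) auto
  have "\<P>(w in P i. trajectory X n w \<in> S) = expectation (\<lambda>w. indicator S (trajectory X n w))"
  proof -
    have "(\<lambda>w. indicator S (trajectory X n w) :: real) =
        indicator {w. trajectory X n w \<in> S}"
      by (auto simp: indicator_def)
    moreover have "{w. trajectory X n w \<in> S} \<inter> space (P i) = {w \<in> space (P i). trajectory X n w \<in> S}"
      by auto
    ultimately show ?thesis by simp
  qed
  also have "\<dots> = (\<Sum>\<^sub>\<infinity>s. (if length s = n then path_weight p i s else 0) * indicator S s)"
    unfolding expectation_discrete(2)[OF measurable_trajectory] prob_trajectory ..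
  also have "\<dots> = (\<Sum>\<^sub>\<infinity>s\<in>{s \<in> S. length s = n}. path_weight p i s)"
    by (rule infsum_cong_neutral) (auto simp: indicator_def)
  finally show "\<P>(w in P i. trajectory X n w \<in> S) = (\<Sum>\<^sub>\<infinity>s\<in>{s \<in> S. length s = n}. path_weight p i s)" .
qed

sublocale stochastic_kernel p
proof
  show "0 \<le> p i j" for i j by (simp add: trans_prob_def)
  fix i n
  interpret prob_space "P i" by (rule prob_space_P)
  have "(\<Sum>\<^sub>\<infinity>s\<in>{s. length s = n}. path_weight p i s) = 1"
    using prob_trajectory_event[of i n UNIV] prob_space by simp
  then show "(path_weight p i has_sum 1) {s. length s = n}"
    by (simp add: has_sum_iff path_weight_length_summable)
qed

lemma AE_last_trajectory: "AE w in P i. last (i # trajectory X n w) = X n w"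
  using start[of i] by eventually_elim (cases n, auto simp: trajectory_Suc trajectory_def)

lemma path_weight_event_summable: "path_weight p i summable_on {s \<in> S. length s = n}"
  by (rule summable_on_subset_banach[OF path_weight_length_summable[of i n]]) auto

lemma measurable_trajectory_event [measurable]:
  "Measurable.pred (P i) (\<lambda>w. trajectory X n w \<in> S)"
  using measurable_trajectory[of n i] by measurable

lemma measurable_X_event [measurable]: "Measurable.pred (P i) (\<lambda>w. X n w \<in> F)"
  using measurable_X[of n i] by measurable

text \<open>
  The event is moved from \<open>X n\<close> to the end of the path from \<open>i\<close>; at time \<open>0\<close> this is where the
  almost sure initial condition enters.
\<close>
lemma prob_trajectory_into:
  "\<P>(w in P i. trajectory X n w \<in> S \<and> X n w \<in> F) =
    (\<Sum>\<^sub>\<infinity>s\<in>{s \<in> paths_into i F \<inter> S. length s = n}. path_weight p i s)"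
proof -
  interpret prob_space "P i" by (rule prob_space_P)
  have "\<P>(w in P i. trajectory X n w \<in> S \<and> X n w \<in> F) =
      \<P>(w in P i. trajectory X n w \<in> paths_into i F \<inter> S)"
  proof (rule prob_eq_AE)
    show "AE w in P i. trajectory X n w \<in> S \<and> X n w \<in> F \<longleftrightarrow> trajectory X n w \<in> paths_into i F \<inter> S"
      using AE_last_trajectory[of i n] by eventually_elim (auto simp: paths_into_def)
  qed measurable
  then show ?thesis by (simp only: prob_trajectory_event)
qed

section \<open>Generating functions as path sums\<close>

lemma GF_conv_iff: "GF_conv P X F i x \<longleftrightarrow> path_weight (step_weight p A x x) i summable_on paths_into i F"
  and GF_eq: "GF P X F i x = path_sum (step_weight p A x x) i (paths_into i F)"
proof -
  have pr: "\<P>(w in P i. X m w \<in> F) = (\<Sum>\<^sub>\<infinity>s\<in>{s \<in> paths_into i F. length s = m}. path_weight p i s)" for m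
    using prob_trajectory_into[of i m UNIV F] by simp
  have nn: "0 \<le> path_weight p i s" for s by (intro path_weight_nonneg kernel_nonneg)
  show "GF_conv P X F i x \<longleftrightarrow> path_weight (step_weight p A x x) i summable_on paths_into i F"
    using summable_on_fibers_iff(1)[of "paths_into i F" "path_weight p i" UNIV length "\<lambda>m. x ^ m"]
    unfolding GF_conv_def pr summable_on_abs_iff path_weight_step_weight_same
    by (simp add: nn path_weight_event_summable)
  show "GF P X F i x = path_sum (step_weight p A x x) i (paths_into i F)"
    using summable_on_fibers_iff(2)[of "paths_into i F" "path_weight p i" UNIV length "\<lambda>m. x ^ m"]
    unfolding GF_def pr path_sum_def path_weight_step_weight_same
    by (simp add: nn path_weight_event_summable)
qed

text \<open>
  Paths are classified by the pair of their sojourn time in \<open>A\<close> and their length.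
\<close>
lemma K_conv_iff: "K_conv P X A F i x y \<longleftrightarrow>
    path_weight (step_weight p A x y) i summable_on paths_into i F"
  and K_eq: "K P X A F i x y = path_sum (step_weight p A x y) i (paths_into i F)"
proof -
  define k where "k s = (length (filter (\<lambda>a. a \<in> A) s), length s)" for s :: "'s list"
  define c where "c = (\<lambda>(m, n). x ^ m * y ^ (n - m))"
  have pr: "\<P>(w in P i. sojourn X A n w = m \<and> X n w \<in> F) =
      (\<Sum>\<^sub>\<infinity>s\<in>{s \<in> paths_into i F. k s = (m, n)}. path_weight p i s)" for m n
  proof -
    have "{s \<in> paths_into i F \<inter> {s. length (filter (\<lambda>a. a \<in> A) s) = m}. length s = n} =
        {s \<in> paths_into i F. k s = (m, n)}"
      by (auto simp: k_def)
    then show ?thesis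
      using prob_trajectory_into[of i n "{s. length (filter (\<lambda>a. a \<in> A) s) = m}" F]
      by (simp add: sojourn_trajectory)
  qed
  have nn: "0 \<le> path_weight p i s" for s by (intro path_weight_nonneg kernel_nonneg)
  have fib: "path_weight p i summable_on {s \<in> paths_into i F. k s = j}" for j
    by (rule summable_on_subset_banach[OF path_weight_length_summable[of i "snd j"]])
       (auto simp: k_def)
  have range: "k ` paths_into i F \<subseteq> {(m, n). m \<le> n}"
    by (auto simp: k_def)
  have weight: "path_weight p i s * c (k s) = path_weight (step_weight p A x y) i s" for s
    using sum_length_filter_compl[of "\<lambda>a. a \<in> A" s]
    by (simp add: c_def k_def path_weight_step_weight) (metis diff_add_inverse)
  have summand: "(\<Sum>\<^sub>\<infinity>s\<in>{s \<in> paths_into i F. k s = (m, n)}. path_weight p i s) * x ^ m * y ^ (n - m) =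
      (\<Sum>\<^sub>\<infinity>s\<in>{s \<in> paths_into i F. k s = (m, n)}. path_weight p i s) * c (m, n)" for m n
    by (simp add: c_def)
  show "K_conv P X A F i x y \<longleftrightarrow> path_weight (step_weight p A x y) i summable_on paths_into i F"
    using summable_on_fibers_iff(1)[OF nn fib range, of c]
    by (simp add: K_conv_def pr summand weight case_prod_unfold summable_on_abs_iff)
  show "K P X A F i x y = path_sum (step_weight p A x y) i (paths_into i F)"
    using summable_on_fibers_iff(2)[OF nn fib range, of c]
    by (simp add: K_def pr summand weight case_prod_unfold path_sum_def)
qed

text \<open>
  The trajectory up to the hitting time takes countably many values and determines the
  integrands of all hitting-time transforms, which makes \<open>expectation_discrete\<close> applicable.
\<close>
definition passage :: "'s set \<Rightarrow> 'w \<Rightarrow> 's list option" where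
  "passage A w = (case hit X A w of enat n \<Rightarrow> Some (trajectory X n w) | \<infinity> \<Rightarrow> None)"

lemma passage_eq_Some_iff:
  "passage A w = Some u \<longleftrightarrow> u \<in> first_passages A \<and> trajectory X (length u) w = u"
proof
  assume "passage A w = Some u"
  then obtain n where n: "hit X A w = enat n" "trajectory X n w = u"
    by (auto simp: passage_def split: enat.splits)
  then have "length u = n" by auto
  then show "u \<in> first_passages A \<and> trajectory X (length u) w = u"
    using n trajectory_first_passage_iff[of X n w A] by simp
next
  assume u: "u \<in> first_passages A \<and> trajectory X (length u) w = u"
  then have "hit X A w = enat (length u)"
    using trajectory_first_passage_iff[of X "length u" w A] by simp
  with u show "passage A w = Some u" by (simp add: passage_def)
qed

lemma measurable_passage [measurable]: "passage A \<in> measurable (P i) (count_space UNIV)"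
proof -
  have some: "{w \<in> space (P i). passage A w = Some u} \<in> sets (P i)" for u
  proof -
    have "{w \<in> space (P i). passage A w = Some u} =
        {w \<in> space (P i). u \<in> first_passages A \<and> trajectory X (length u) w \<in> {u}}"
      by (auto simp: passage_eq_Some_iff)
    also have "\<dots> \<in> sets (P i)" by measurable
    finally show ?thesis .
  qed
  show ?thesis
    unfolding measurable_count_space_eq2_countable
  proof (intro conjI ballI)
    fix z :: "'s list option"
    show "passage A -` {z} \<inter> space (P i) \<in> sets (P i)"
    proof (cases z)
      case None
      have "passage A -` {None} \<inter> space (P i) =
          space (P i) - (\<Union>u. {w \<in> space (P i). passage A w = Some u})"
        by auto
      also have "\<dots> \<in> sets (P i)"
        using some by (intro sets.Diff sets.countable_UN') auto
      finally show ?thesis using None by simp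
    next
      case (Some u)
      have "passage A -` {Some u} \<inter> space (P i) = {w \<in> space (P i). passage A w = Some u}"
        by auto
      with some[of u] Some show ?thesis by simp
    qed
  qed auto
qed

lemma prob_passage: "\<P>(w in P i. passage A w = Some u) =
    (if u \<in> first_passages A then path_weight p i u else 0)"
  using prob_trajectory[of i "length u" u] by (simp add: passage_eq_Some_iff)

text \<open>
  On infinite hitting times the integrand is zero, so only first-passage paths contribute. The set
  \<open>B\<close> is arbitrary because both variables of the kernel are \<open>x\<close>.
\<close>
lemma Ho_conv_iff: "Ho_conv P X A V i j x \<longleftrightarrow> path_weight (step_weight p B x x) i
      summable_on {u \<in> first_passages A. hd u \<in> V \<and> last u = j}"
  and Ho_eq: "Ho P X A V i j x =
    path_sum (step_weight p B x x) i {u \<in> first_passages A. hd u \<in> V \<and> last u = j}"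
proof -
  interpret prob_space "P i" by (rule prob_space_P)
  define g :: "'s list option \<Rightarrow> real" where
    "g z = (case z of None \<Rightarrow> 0 | Some u \<Rightarrow> if hd u \<in> V \<and> last u = j then x ^ length u else 0)" for z
  let ?S = "{u \<in> first_passages A. hd u \<in> V \<and> last u = j}"
  have val: "(if X 1 w \<in> V then H_term X A j x w else 0) = g (passage A w)" for w
  proof (cases "hit X A w")
    case (enat n)
    then have "0 < n" by (simp add: hit_eq_enat_iff)
    then have "hd (trajectory X n w) = X 1 w" "last (trajectory X n w) = X n w"
      using hd_trajectory[of n X w] trajectory_Suc[of X "n - 1" w] by simp_all
    then show ?thesis by (simp add: H_term_def passage_def g_def enat)
  qed (simp add: H_term_def passage_def g_def)
  let ?f = "\<lambda>z. \<P>(w in P i. passage A w = z) * g z"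
  have out: "?f z = 0" if "z \<notin> Some ` ?S" for z
    using that by (cases z) (auto simp: g_def prob_passage)
  have on: "?f (Some u) = path_weight (step_weight p B x x) i u" if "u \<in> ?S" for u
    using that by (simp add: prob_passage g_def path_weight_step_weight_same)
  have inj: "inj_on Some ?S" by simp
  have "Ho_conv P X A V i j x \<longleftrightarrow> ?f summable_on UNIV"
    unfolding Ho_conv_def val by (rule expectation_discrete(1)[OF measurable_passage])
  also have "\<dots> \<longleftrightarrow> ?f summable_on Some ` ?S"
    by (rule summable_on_cong_neutral) (use out in auto)
  also have "\<dots> \<longleftrightarrow> path_weight (step_weight p B x x) i summable_on ?S"
    unfolding summable_on_reindex[OF inj] o_def by (rule summable_on_cong) (rule on)
  finally show "Ho_conv P X A V i j x \<longleftrightarrow> path_weight (step_weight p B x x) i summable_on ?S" .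
  have "Ho P X A V i j x = infsum ?f UNIV"
    unfolding Ho_def val by (rule expectation_discrete(2)[OF measurable_passage])
  also have "\<dots> = infsum ?f (Some ` ?S)"
    by (rule infsum_cong_neutral) (use out in auto)
  also have "\<dots> = path_sum (step_weight p B x x) i ?S"
    unfolding infsum_reindex[OF inj] o_def path_sum_def by (rule infsum_cong) (rule on)
  finally show "Ho P X A V i j x = path_sum (step_weight p B x x) i ?S" .
qed

lemma H_conv_iff: "H_conv P X A i j x \<longleftrightarrow>
    path_weight (step_weight p B x x) i summable_on {u \<in> first_passages A. last u = j}"
  and H_eq: "H P X A i j x = path_sum (step_weight p B x x) i {u \<in> first_passages A. last u = j}"
  using Ho_conv_iff[of A UNIV i j x B] Ho_eq[of A UNIV i j x B]
  by (simp_all add: Ho_conv_def Ho_def H_conv_def H_def)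

text \<open>
  An almost sure property holds at some outcome that follows any given path of positive
  probability. This transfers statements about hitting times to single paths.
\<close>
lemma possible_path_realised:
  assumes "path_weight p i u \<noteq> 0" and "AE w in P i. Q w"
  obtains w where "trajectory X (length u) w = u" "Q w"
proof -
  interpret prob_space "P i" by (rule prob_space_P)
  have "\<not> (AE w in P i. trajectory X (length u) w \<notin> {u})"
  proof
    assume "AE w in P i. trajectory X (length u) w \<notin> {u}"
    then have "\<P>(w in P i. trajectory X (length u) w \<in> {u}) = 0"
      by (subst prob_Collect_eq_0) auto
    then show False using assms(1) prob_trajectory[of i "length u" u] by simp
  qed
  moreover have "AE w in P i. trajectory X (length u) w \<notin> {u}"
    if "\<And>w. Q w \<Longrightarrow> trajectory X (length u) w \<noteq> u"
    using assms(2) by eventually_elim (use that in auto)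
  ultimately show thesis using that by blast
qed

lemma gateway_assumptions:
  assumes sub: "Eo \<subseteq> Ed" and A1: "assumption_A1 P X Eo Ed" and A2: "assumption_A2 P X Eo Ed"
  shows "gateway p Eo Ed"
proof
  fix i u
  assume i: "i \<notin> Ed" and u: "u \<in> first_passages Ed" and w: "path_weight p i u \<noteq> 0"
  from A1 i have "AE w in P i. hit X Eo w = hit X Ed w" by (auto simp: assumption_A1_def)
  from possible_path_realised[OF w this] obtain w where
    w: "trajectory X (length u) w = u" "hit X Eo w = hit X Ed w" .
  then have "hit X Eo w = enat (length u)"
    using u trajectory_first_passage_iff[of X "length u" w Ed] by simp
  then have "u \<in> first_passages Eo"
    using w(1) trajectory_first_passage_iff[of X "length u" w Eo] by simp
  then show "last u \<in> Eo" by (simp add: first_passages_def)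
next
  fix i u
  assume i: "i \<in> Ed - Eo" and u: "u \<in> first_passages (- Ed)" and w: "path_weight p i u \<noteq> 0"
  from A2 i have "AE w in P i. hit X Eo w \<le> hit X (- Ed) w - 1" by (auto simp: assumption_A2_def)
  from possible_path_realised[OF w this] obtain w where
    w: "trajectory X (length u) w = u" "hit X Eo w \<le> hit X (- Ed) w - 1" .
  then have "hit X (- Ed) w = enat (length u)"
    using u trajectory_first_passage_iff[of X "length u" w "- Ed"] by simp
  with w(2) have "hit X Eo w \<le> enat (length u)"
    by (metis diff_le_self enat_ord_simps(1) idiff_enat_enat one_enat_def order_trans)
  then obtain n where n: "hit X Eo w = enat n" "n \<le> length u"
    by (cases "hit X Eo w") auto
  then have "X n w \<in> Eo" "1 \<le> n" by (auto simp: hit_eq_enat_iff)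
  moreover have "set u = {X m w | m. 1 \<le> m \<and> m \<le> length u}"
    using set_trajectory[of X "length u" w] w(1) by simp
  ultimately show "set u \<inter> Eo \<noteq> {}" using n(2) by blast
qed (rule sub)

section \<open>The functional equations\<close>

lemma G_GF: "G P X i j x = GF P X {j} i x" "G_conv P X i j x = GF_conv P X {j} i x"
  by (simp_all add: G_def GF_def G_conv_def GF_conv_def)

lemma K_x_0:
  assumes "Kx0_conv P X Ed F i x"
  shows "K P X Ed F i x 0 = GF P X F i x - (\<Sum>\<^sub>\<infinity>j\<in>- Ed. H P X (- Ed) i j x * GF P X F j x)"
proof -
  have "path_weight (step_weight p Ed x x) i summable_on paths_into i F"
    using assms GF_conv_iff[of F i x Ed] by (simp add: Kx0_conv_def)
  from path_sum_avoiding[OF this, of "- Ed"] show ?thesis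
    by (simp add: K_eq GF_eq[of F _ x Ed] H_eq[of "- Ed" _ _ x Ed]
        path_sum_step_weight_inside[of p Ed x i "paths_into i F" x])
qed

lemma K_0_y:
  assumes "K0y_conv P X Ed F i y"
  shows "K P X Ed F i 0 y = GF P X F i y - (\<Sum>\<^sub>\<infinity>j\<in>Ed. H P X Ed i j y * GF P X F j y)"
proof -
  have "path_weight (step_weight p Ed y y) i summable_on paths_into i F"
    using assms GF_conv_iff[of F i y Ed] by (simp add: K0y_conv_def)
  from path_sum_avoiding[OF this, of Ed] show ?thesis
    by (simp add: K_eq GF_eq[of F _ y Ed] H_eq[of Ed _ _ y Ed]
        path_sum_step_weight_outside[of p Ed y i "paths_into i F" y])
qed

text \<open>
  A path ending at \<open>j \<in> A\<close> avoids \<open>A\<close> only if it is empty, which accounts for the Kronecker symbol.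
\<close>
lemma G_first_passage:
  assumes "j \<in> A" and "G_conv P X i j x"
  shows "G P X i j x = (if i = j then 1 else 0) + (\<Sum>\<^sub>\<infinity>k\<in>A. H P X A i k x * G P X k j x)"
proof -
  have "path_weight (step_weight p A x x) i summable_on paths_into i {j}"
    using assms(2) GF_conv_iff[of "{j}" i x A] by (simp add: G_GF)
  note avoid = path_sum_avoiding[OF this, of A]
  have "{s \<in> paths_into i {j}. set s \<inter> A = {}} = (if i = j then {[]} else {})"
  proof -
    have "s = []" if "s \<in> paths_into i {j}" "set s \<inter> A = {}" for s
    proof (rule ccontr)
      assume "s \<noteq> []"
      then have "j \<in> set s" using that(1) by (auto simp: paths_into_def)
      with that(2) assms(1) show False by blast
    qed
    then have "{s \<in> paths_into i {j}. set s \<inter> A = {}} = paths_into i {j} \<inter> {[]}"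
      by (intro equalityI subsetI) auto
    also have "\<dots> = (if i = j then {[]} else {})"
      by (simp add: paths_into_def)
    finally show ?thesis .
  qed
  then have "path_sum (step_weight p A x x) i {s \<in> paths_into i {j}. set s \<inter> A = {}} =
      (if i = j then 1 else 0)"
    by (simp only: if_distrib[where f = "path_sum (step_weight p A x x) i"]
        path_sum_single path_sum_empty path_weight.simps)
  with avoid show ?thesis
    unfolding G_GF GF_eq[of _ _ x A] H_eq[of A _ _ x A] by simp
qed

lemma Ho_inside:
  assumes "Eo \<subseteq> Ed" "j \<in> Eo" and "Ho_conv P X Eo Ed i j x"
  shows "Ho P X Eo Ed i j x = x * (p i j + (\<Sum>\<^sub>\<infinity>k\<in>Ed - Eo. p i k * H P X Eo k j x))"
proof -
  have "path_weight (step_weight p UNIV x x) i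
      summable_on {u \<in> first_passages Eo. hd u \<in> Ed \<and> last u = j}"
    using assms(3) Ho_conv_iff[of Eo Ed i j x UNIV] by simp
  from path_sum_first_passage_starting_in[OF assms(2,1) this]
  have "Ho P X Eo Ed i j x = p i j * x + (\<Sum>\<^sub>\<infinity>k\<in>Ed - Eo. x * (p i k * H P X Eo k j x))"
    by (simp add: Ho_eq[of Eo Ed i j x UNIV] H_eq[of Eo _ j x UNIV] step_weight_def mult_ac)
  then show ?thesis by (simp add: infsum_cmult_right' algebra_simps)
qed

lemma Ho_outside:
  assumes "Eo \<inter> V = {}" and "Ho_conv P X Eo V i j x"
  shows "Ho P X Eo V i j x = x * (\<Sum>\<^sub>\<infinity>k\<in>V. p i k * H P X Eo k j x)"
proof -
  have "path_weight (step_weight p UNIV x x) i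
      summable_on {u \<in> first_passages Eo. hd u \<in> V \<and> last u = j}"
    using assms(2) Ho_conv_iff[of Eo V i j x UNIV] by simp
  from path_sum_first_passage_avoiding[OF _ this]
  have "Ho P X Eo V i j x = (\<Sum>\<^sub>\<infinity>k\<in>V. x * (p i k * H P X Eo k j x))"
    using assms(1)
    by (simp add: Ho_eq[of Eo V i j x UNIV] H_eq[of Eo _ j x UNIV] step_weight_def mult_ac Int_commute)
  then show ?thesis by (simp add: infsum_cmult_right')
qed

lemma K_main_equation:
  assumes "Eo \<subseteq> Ed" "assumption_A1 P X Eo Ed" "assumption_A2 P X Eo Ed"
    and "y \<noteq> 0" and conv: "main_conv P X Eo Ed F i x y"
  shows "K P X Ed F i x y = K P X Ed F i x 0 + K P X Ed F i 0 y
    + (\<Sum>\<^sub>\<infinity>j\<in>Eo. (Ho P X Eo Ed i j x + x / y * Ho P X Eo (- Ed) i j y) * K P X Ed F j x y)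
    - (\<Sum>\<^sub>\<infinity>j\<in>Eo. Ho P X Eo Ed i j x * K P X Ed F j x 0) - indicator F i"
proof -
  interpret gateway p Eo Ed by (rule gateway_assumptions) fact+
  have out: "Ho P X Eo (- Ed) i j y =
      path_sum (step_weight p Ed y y) i {u \<in> first_passages Eo. hd u \<notin> Ed \<and> last u = j}" for j
    by (simp add: Ho_eq[of Eo "- Ed" i j y Ed])
  show ?thesis
    unfolding K_eq out Ho_eq[of Eo Ed _ _ _ Ed]
    by (rule path_sum_gateway)
       (use conv \<open>y \<noteq> 0\<close> in \<open>auto simp: main_conv_def summable_on_abs_iff K_conv_iff K_eq out
          Ho_eq[of Eo Ed _ _ _ Ed]\<close>)
qed

lemma H_abs_summable:
  assumes "\<bar>x\<bar> < 1"
  shows "(\<lambda>k. \<bar>H P X A i k x\<bar>) summable_on A"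
  using dominated_kernel.passage_sums_summable[OF step_weight_dominated[OF assms assms, of A], of i A UNIV]
  by (simp add: H_eq[of A _ _ x A])

lemma GF_convergent: "\<bar>x\<bar> < 1 \<Longrightarrow> GF_conv P X F i x"
  unfolding GF_conv_iff[of F i x UNIV]
  by (rule dominated_kernel.path_weight_summable[OF step_weight_dominated])

lemma GF_bound: "\<bar>x\<bar> < 1 \<Longrightarrow> \<bar>GF P X F i x\<bar> \<le> 1 / (1 - \<bar>x\<bar>)"
  unfolding GF_eq[of F i x UNIV]
  using dominated_kernel.abs_path_sum_bound[OF step_weight_dominated[of x x UNIV]] by simp

lemma K_convergent: "\<bar>x\<bar> < 1 \<Longrightarrow> \<bar>y\<bar> < 1 \<Longrightarrow> K_conv P X A F i x y"
  unfolding K_conv_iff by (rule dominated_kernel.path_weight_summable[OF step_weight_dominated])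

lemma K_bound: "\<bar>x\<bar> < 1 \<Longrightarrow> \<bar>y\<bar> < 1 \<Longrightarrow> \<bar>K P X A F i x y\<bar> \<le> 1 / (1 - max \<bar>x\<bar> \<bar>y\<bar>)"
  unfolding K_eq by (rule dominated_kernel.abs_path_sum_bound[OF step_weight_dominated])

lemma Ho_convergent: "\<bar>x\<bar> < 1 \<Longrightarrow> Ho_conv P X A V i j x"
  unfolding Ho_conv_iff[of A V i j x UNIV]
  by (rule dominated_kernel.path_weight_summable[OF step_weight_dominated])

lemma Ho_abs_summable:
  assumes "\<bar>x\<bar> < 1"
  shows "(\<lambda>j. \<bar>Ho P X A V i j x\<bar>) summable_on A"
  using dominated_kernel.passage_sums_summable[OF step_weight_dominated[OF assms assms, of A], of i A V]
  by (simp add: Ho_eq[of A V _ _ x A])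

lemma H_convergent: "\<bar>x\<bar> < 1 \<Longrightarrow> H_conv P X A i j x"
  unfolding H_conv_iff[of A i j x UNIV]
  by (rule dominated_kernel.path_weight_summable[OF step_weight_dominated])

lemma H_bound: "\<bar>x\<bar> < 1 \<Longrightarrow> \<bar>H P X A i j x\<bar> \<le> 1 / (1 - \<bar>x\<bar>)"
  unfolding H_eq[of A i j x UNIV]
  using dominated_kernel.abs_path_sum_bound[OF step_weight_dominated[of x x UNIV]] by simp

text \<open>
  The coefficients \<open>Ho\<close> are absolutely summable over the hitting state, as sums over disjoint sets of
  paths, and they multiply values of \<open>K\<close> that are bounded uniformly in the starting state. The case
  \<open>y = 0\<close> is included, with \<open>x / 0 = 0\<close>.
\<close>
lemma main_convergent:
  assumes x: "\<bar>x\<bar> < 1" and y: "\<bar>y\<bar> < 1"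
  shows "main_conv P X Eo Ed F i x y"
proof -
  have "(\<lambda>j. Ho P X Eo Ed i j x + x / y * Ho P X Eo (- Ed) i j y) summable_on Eo"
    using Ho_abs_summable[OF x, of Eo Ed i] Ho_abs_summable[OF y, of Eo "- Ed" i]
    by (intro summable_on_add summable_on_cmult_right) (simp_all add: summable_on_abs_iff)
  then have "(\<lambda>j. \<bar>Ho P X Eo Ed i j x + x / y * Ho P X Eo (- Ed) i j y\<bar>) summable_on Eo"
    by (simp add: summable_on_abs_iff)
  then have "(\<lambda>j. \<bar>(Ho P X Eo Ed i j x + x / y * Ho P X Eo (- Ed) i j y) * K P X Ed F j x y\<bar>)
      summable_on Eo"
    by (rule summable_on_mult_bounded) (rule K_bound[OF x y])
  moreover have "(\<lambda>j. \<bar>Ho P X Eo Ed i j x * K P X Ed F j x 0\<bar>) summable_on Eo"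
    by (rule summable_on_mult_bounded[OF Ho_abs_summable[OF x]]) (rule K_bound[OF x], simp)
  ultimately show ?thesis
    unfolding main_conv_def
    using x y by (auto intro: K_convergent Ho_convergent)
qed

lemma Kx0_convergent: "\<bar>x\<bar> < 1 \<Longrightarrow> Kx0_conv P X Ed F i x"
  unfolding Kx0_conv_def
  by (auto intro: K_convergent GF_convergent H_convergent summable_on_mult_bounded H_abs_summable GF_bound)

lemma K0y_convergent: "\<bar>y\<bar> < 1 \<Longrightarrow> K0y_conv P X Ed F i y"
  unfolding K0y_conv_def
  by (auto intro: K_convergent GF_convergent H_convergent summable_on_mult_bounded H_abs_summable GF_bound)

lemma G_eq_convergent: "\<bar>x\<bar> < 1 \<Longrightarrow> G_eq_conv P X A i j x"
  unfolding G_eq_conv_def G_GF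
  by (auto intro: GF_convergent H_convergent summable_on_mult_bounded H_abs_summable GF_bound)

lemma Ho_eq_convergent: "\<bar>x\<bar> < 1 \<Longrightarrow> Ho_eq_conv P X Eo V B i j x"
  unfolding Ho_eq_conv_def
  by (auto intro: Ho_convergent H_convergent summable_on_mult_bounded kernel_row_summable H_bound)

text \<open>
  The first-passage sums solve the same equations as \<open>h\<close>, so the difference is annihilated by the
  Green function.
\<close>
lemma first_passage_equations_unique:
  assumes x: "\<bar>x\<bar> < 1" and h: "(\<lambda>k. \<bar>h k\<bar>) summable_on A"
    and eq: "\<And>j. j \<in> A \<Longrightarrow>
      G P X i j x = (if i = j then 1 else 0) + (\<Sum>\<^sub>\<infinity>k\<in>A. h k * G P X k j x)"
    and "k \<in> A"
  shows "h k = H P X A i k x"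
proof -
  interpret dominated_kernel p "step_weight p A x x" "max \<bar>x\<bar> \<bar>x\<bar>"
    by (rule step_weight_dominated[OF x x])
  define d where "d k = h k - H P X A i k x" for k
  have "d summable_on A"
    unfolding d_def diff_conv_add_uminus using h H_abs_summable[OF x, of A i]
    by (intro summable_on_add) (auto simp: summable_on_abs_iff summable_on_uminus)
  moreover have "(\<Sum>\<^sub>\<infinity>k\<in>A. d k * path_sum (step_weight p A x x) k (paths_into k {l})) = 0" if "l \<in> A" for l
  proof -
    have G: "path_sum (step_weight p A x x) k (paths_into k {l}) = G P X k l x" for k
      by (simp add: G_GF GF_eq[of _ _ x A])
    have mult: "(\<lambda>k. f k * G P X k l x) summable_on A" if "(\<lambda>k. \<bar>f k\<bar>) summable_on A" for f
      using summable_on_mult_bounded[OF that, of "\<lambda>k. G P X k l x" "1 / (1 - \<bar>x\<bar>)"] GF_bound[OF x]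
      by (simp add: G_GF summable_on_abs_iff)
    have "(\<Sum>\<^sub>\<infinity>k\<in>A. d k * G P X k l x) =
        (\<Sum>\<^sub>\<infinity>k\<in>A. h k * G P X k l x + - (H P X A i k x * G P X k l x))"
      by (simp add: d_def algebra_simps)
    also have "\<dots> = (\<Sum>\<^sub>\<infinity>k\<in>A. h k * G P X k l x) + - (\<Sum>\<^sub>\<infinity>k\<in>A. H P X A i k x * G P X k l x)"
      using mult[OF h] mult[OF H_abs_summable[OF x]]
      by (simp add: infsum_add summable_on_uminus infsum_uminus del: add_uminus_conv_diff)
    also have "\<dots> = 0"
      using eq[OF that] G_first_passage[OF that, of i x] GF_convergent[OF x] by (simp add: G_GF)
    finally show ?thesis by (simp only: G)
  qed
  ultimately have "d k = 0"
    by (rule green_function_injective[OF _ \<open>k \<in> A\<close>])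
  then show ?thesis by (simp add: d_def)
qed

end

theorem theorem3p1:
  fixes P :: "'s::countable \<Rightarrow> 'w measure" and X :: "nat \<Rightarrow> 'w \<Rightarrow> 's"
    and Eo Ed F :: "'s set"
  assumes "homogeneous_markov_chain P X"
    and "Eo \<subseteq> Ed"
    and "assumption_A1 P X Eo Ed"
    and "assumption_A2 P X Eo Ed"
  shows
    "(\<forall>i x y. y \<noteq> 0 \<and> main_conv P X Eo Ed F i x y \<longrightarrow>
        K P X Ed F i x y =
          K P X Ed F i x 0 + K P X Ed F i 0 y
          + (\<Sum>\<^sub>\<infinity>j\<in>Eo. (Ho P X Eo Ed i j x + x / y * Ho P X Eo (- Ed) i j y) * K P X Ed F j x y)
          - (\<Sum>\<^sub>\<infinity>j\<in>Eo. Ho P X Eo Ed i j x * K P X Ed F j x 0)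
          - indicator F i) \<and>
     (\<forall>i x. Kx0_conv P X Ed F i x \<longrightarrow>
        K P X Ed F i x 0 = GF P X F i x - (\<Sum>\<^sub>\<infinity>j\<in>- Ed. H P X (- Ed) i j x * GF P X F j x)) \<and>
     (\<forall>i y. K0y_conv P X Ed F i y \<longrightarrow>
        K P X Ed F i 0 y = GF P X F i y - (\<Sum>\<^sub>\<infinity>j\<in>Ed. H P X Ed i j y * GF P X F j y)) \<and>
     (\<forall>i. \<forall>j\<in>Ed. \<forall>x. G_eq_conv P X Ed i j x \<longrightarrow>
        G P X i j x = (if i = j then 1 else 0) + (\<Sum>\<^sub>\<infinity>k\<in>Ed. H P X Ed i k x * G P X k j x)) \<and>
     (\<forall>i. \<forall>j\<in>- Ed. \<forall>x. G_eq_conv P X (- Ed) i j x \<longrightarrow>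
        G P X i j x = (if i = j then 1 else 0) + (\<Sum>\<^sub>\<infinity>k\<in>- Ed. H P X (- Ed) i k x * G P X k j x)) \<and>
     (\<forall>i x h. \<bar>x\<bar> < 1 \<and> (\<lambda>k. \<bar>h k\<bar>) summable_on Ed \<and>
        (\<forall>j\<in>Ed. G P X i j x = (if i = j then 1 else 0) + (\<Sum>\<^sub>\<infinity>k\<in>Ed. h k * G P X k j x)) \<longrightarrow>
        (\<forall>k\<in>Ed. h k = H P X Ed i k x)) \<and>
     (\<forall>i x h. \<bar>x\<bar> < 1 \<and> (\<lambda>k. \<bar>h k\<bar>) summable_on (- Ed) \<and>
        (\<forall>j\<in>- Ed. G P X i j x = (if i = j then 1 else 0) + (\<Sum>\<^sub>\<infinity>k\<in>- Ed. h k * G P X k j x)) \<longrightarrow>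
        (\<forall>k\<in>- Ed. h k = H P X (- Ed) i k x)) \<and>
     (\<forall>i. \<forall>j\<in>Eo. \<forall>x. Ho_eq_conv P X Eo Ed (Ed - Eo) i j x \<longrightarrow>
        Ho P X Eo Ed i j x =
          x * (trans_prob P X i j + (\<Sum>\<^sub>\<infinity>k\<in>Ed - Eo. trans_prob P X i k * H P X Eo k j x))) \<and>
     (\<forall>i. \<forall>j\<in>Eo. \<forall>x. Ho_eq_conv P X Eo (- Ed) (- Ed) i j x \<longrightarrow>
        Ho P X Eo (- Ed) i j x =
          x * (\<Sum>\<^sub>\<infinity>k\<in>- Ed. trans_prob P X i k * H P X Eo k j x)) \<and>
     (\<forall>i x y. \<bar>x\<bar> < 1 \<and> \<bar>y\<bar> < 1 \<longrightarrow>
        main_conv P X Eo Ed F i x y \<and> Kx0_conv P X Ed F i x \<and> K0y_conv P X Ed F i y \<and>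
        (\<forall>j\<in>Ed. G_eq_conv P X Ed i j x) \<and> (\<forall>j\<in>- Ed. G_eq_conv P X (- Ed) i j x) \<and>
        (\<forall>j\<in>Eo. Ho_eq_conv P X Eo Ed (Ed - Eo) i j x \<and> Ho_eq_conv P X Eo (- Ed) (- Ed) i j x)) \<and>
     (\<forall>i x. \<bar>x\<bar> < 1 \<longrightarrow>
        (\<lambda>k. \<bar>H P X Ed i k x\<bar>) summable_on Ed \<and>
        (\<lambda>k. \<bar>H P X (- Ed) i k x\<bar>) summable_on (- Ed))"
proof -
  interpret homogeneous_markov_chain P X by fact
  have disj: "Eo \<inter> - Ed = {}" using assms(2) by auto
  show ?thesis
  proof (intro conjI, goal_cases)
    case 1 show ?case using K_main_equation[OF assms(2-4)] by blast
  next
    case 2 show ?case using K_x_0 by blast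
  next
    case 3 show ?case using K_0_y by blast
  next
    case 4 show ?case using G_first_passage unfolding G_eq_conv_def by blast
  next
    case 5 show ?case using G_first_passage unfolding G_eq_conv_def by blast
  next
    case 6 show ?case using first_passage_equations_unique[of _ _ Ed] by blast
  next
    case 7 show ?case using first_passage_equations_unique[of _ _ "- Ed"] by blast
  next
    case 8 show ?case using Ho_inside[OF assms(2)] unfolding Ho_eq_conv_def by blast
  next
    case 9 show ?case using Ho_outside[OF disj] unfolding Ho_eq_conv_def by blast
  next
    case 10 show ?case
      by (simp add: main_convergent Kx0_convergent K0y_convergent G_eq_convergent Ho_eq_convergent)
  next
    case 11 show ?case using H_abs_summable by blast
  qed
qed

end
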